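(* Assume (SA1) and (SA3) hold with $\eta(n)=A n^{-\psi}$ for some $\psi>1$; (SA2) holds with $\alpha(n)=A' n^{-\gamma}$ for some $\gamma>0$; and (SA4) holds with some $\zeta>0$ (the assumptions (SA1)–(SA4) are spelled out in the context; $A,A'$ are constants). Fix an arbitrarily small $\delta>0$. Then there exists $\Omega_*\subset\Omega$ with $\mathbb P(\Omega_* )=1$ such that all of the following holds. The non-random number $$\sigma^2=\sum_{k=0}^\infty(2-\delta_{k0})\lim_{i\to\infty}\bar{\mathbb E}\bigl[\mu(f_if_{i+k})-\mu(f_i)\mu(f_{i+k})\bigr]$$ is well defined and nonnegative, the series is absolutely convergent, and $\lim_{n\to\infty}\sigma_n^2(\omega)=\sigma^2$ for every $\omega\in\Omega_*$. Moreover, the absolute difference $\Delta_n(\omega)=|\sigma_n^2(\omega)-\sigma^2|$ has the following upper bounds as $n\to\infty$, for any $\omega\in\Omega_*$: $$\Delta_n=\begin{cases} O(n^{-\frac12}\log^{\frac32+\delta}n), & \zeta\ge1,\ \min\{\psi-1,\gamma\}>1,\\ O(n^{-\frac12+\delta}), & \zeta\ge1,\ \min\{\psi-1,\gamma\}=1,\\ O(n^{-\frac{\min\{\psi-1,\gamma\}}2}\log^{\frac32+\delta}n), & \zeta\ge1,\ 0<\min\{\psi-1,\gamma\}<1,\\ O(n^{\frac\zeta\psi-\zeta}+n^{-\frac12}\log^{\frac32+\delta}n), & 0<\zeta<1,\ \min\{\psi-1,\gamma\}>1,\\ O(n^{\frac\zeta\psi-\zeta}+n^{-\frac12+\delta}),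 & 0<\zeta<1,\ \min\{\psi-1,\gamma\}=1,\\ O(n^{\frac\zeta\psi-\zeta}+n^{-\frac{\min\{\psi-1,\gamma\}}2}\log^{\frac32+\delta}n), & 0<\zeta<1,\ 0<\min\{\psi-1,\gamma\}<1. \end{cases}$$
   Context: Setting. $(\Omega_0,\mathcal E)$ and $(X,\mathcal B)$ are measurable spaces, $\mathbb Z_+=\{1,2,\dots\}$, $\mathbb N=\{0,1,\dots\}$, $\Omega=\Omega_0^{\mathbb Z_+}$ with product sigma-algebra $\mathcal F$, and $\mathbb P$ is a probability measure on $(\Omega,\mathcal F)$ (not assumed product or shift-invariant), with expectation $\mathbb E$. $\tau:\Omega\to\Omega$, $\tau(\omega_1,\omega_2,\dots)=(\omega_2,\omega_3,\dots)$ is the shift. For each $\omega_0\in\Omega_0$, $T_{\omega_0}:X\to X$ is measurable. Put $\varphi(n,\omega)=\varphi(n,\omega,\cdot)=T_{\omega_n}\circ\dots\circ T_{\omega_1}$, $\varphi(0,\omega)=\mathrm{id}_X$; for each $n$ the map $(\omega,x)\mapsto\varphi(n,\omega,x)$ is assumed measurable. $\mu$ is a probability measure on $(X,\mathcal B)$, $\mu(g)=\int g\,d\mu$, and $f:X\to\mathbb R$ is bounded measurable. Put $f_i=f\circ\varphi(i,\omega)$, $\bar f_i=f_i-\mu(f_i)$ and $\sigma_n^2=\sigma_n^2(\omega)=\frac1n\sum_{i=0}^{n-1}\sum_{j=0}^{n-1}\mu(\bar f_i\bar f_j)$. Here $\delta_{k0}$ is the Kronecker delta and $\log^p n=(\log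 n)^p$. (SA1) There is a non-increasing $\eta:\mathbb N\to[0,\infty)$ with $\sum_i\eta(i)<\infty$ such that, for $\mathbb P$-almost every $\omega$, $|\mu(\bar f_i\bar f_j)|\le\eta(|i-j|)$ for all $i,j\ge0$. (SA2) There is a non-increasing sequence $(\alpha(n))_{n\ge1}$ with $\alpha(n)\to0$ and $\sup_{i\ge1}\sup\{|\mathbb P(A\cap B)-\mathbb P(A)\mathbb P(B)|: A\in\mathcal F_1^i,\ B\in\mathcal F_{i+n}^\infty\}\le\alpha(n)$ for all $n\ge1$, where $\mathcal F_i^j$ is the sigma-algebra generated by the coordinates $\omega_m$, $i\le m\le j$. (SA3) There is a constant $C\ge0$ such that, for $\mathbb P$-almost every $\omega$ and all $0\le r\le k$, $|\mu(g\circ\varphi(k,\omega))-\mu(g\circ\varphi(k-r,\tau^r\omega))|\le C\eta(k-r)$ for every $g\in\{f\circ\varphi(m,\tau^k\omega):m\ge0\}\cup\{f\cdot(f\circ\varphi(m,\tau^k\omega)):m\ge0\}$, with the same $\eta$ as in (SA1). (SA4) $\mathbb P$ is asymptotically mean stationary with mean $\bar{\mathbb P}$, i.e. there is a probability measure $\bar{\mathbb P}$ on $(\Omega,\mathcal F)$ (necessarily $\tau$-invariant) with $\lim_{n\to\infty}\frac1n\sum_{i=0}^{n-1}\int g\circ\tau^i\,d\mathbb P=\int g\,d\bar{\mathbb P}$ for all bounded measurable $g:\Omega\to\mathbb R$; and there are $C_0>0$, $\zeta>0$ such that $\sup_{r,k\ge0,\,a\in\{1,2\}}\bigl|\frac1n\sum_{i=0}^{n-1}\int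 g^a_{rk}\circ\tau^i\,d\mathbb P-\int g^a_{rk}\,d\bar{\mathbb P}\bigr|\le C_0n^{-\zeta}$ for all $n\ge1$, where $g^1_{rk}(\omega)=\mu(f_rf_{r+k})$ and $g^2_{rk}(\omega)=\mu(f_r)\mu(f_{r+k})$. $\bar{\mathbb E}$ denotes expectation with respect to $\bar{\mathbb P}$. Convention: $\eta(n)=An^{-\psi}$ is understood with $0^{-\psi}:=1$. *)

theory Defs
  imports "HOL-Probability.Probability" "HOL-Library.Landau_Symbols"
begin

text \<open>
  Sequences \<open>(\<omega>\<^sub>1, \<omega>\<^sub>2, \<dots>)\<close> are elements of the product over the index set \<open>{1..}\<close>, so the
  indices agree with the mathematical ones. As elements of such a product are extensional functions,
  the shift has to be restricted to \<open>{1..}\<close>.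
\<close>

abbreviation seq_space :: "'o measure \<Rightarrow> (nat \<Rightarrow> 'o) measure" where
  "seq_space M0 \<equiv> PiM {1..} (\<lambda>_. M0)"

definition shift :: "(nat \<Rightarrow> 'o) \<Rightarrow> nat \<Rightarrow> 'o" where
  "shift \<omega> = (\<lambda>n\<in>{1..}. \<omega> (Suc n))"

primrec phi :: "('o \<Rightarrow> 'x \<Rightarrow> 'x) \<Rightarrow> nat \<Rightarrow> (nat \<Rightarrow> 'o) \<Rightarrow> 'x \<Rightarrow> 'x" where
  "phi T 0 \<omega> = id"
| "phi T (Suc n) \<omega> = T (\<omega> (Suc n)) \<circ> phi T n \<omega>"

text \<open>The measurable space \<open>(X, \<B>)\<close> is the one underlying \<open>\<mu>\<close>.\<close>

locale random_composition =
  fixes M0 :: "'o measure" and P :: "(nat \<Rightarrow> 'o) measure" and \<mu> :: "'x measure"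
    and T :: "'o \<Rightarrow> 'x \<Rightarrow> 'x" and f :: "'x \<Rightarrow> real"
  assumes prob_P: "prob_space P"
    and sets_P: "sets P = sets (seq_space M0)"
    and prob_mu: "prob_space \<mu>"
    and measurable_T: "\<And>w. w \<in> space M0 \<Longrightarrow> T w \<in> measurable \<mu> \<mu>"
    and measurable_phi: "\<And>n. (\<lambda>(\<omega>, x). phi T n \<omega> x) \<in> measurable (seq_space M0 \<Otimes>\<^sub>M \<mu>) \<mu>"
    and measurable_f: "f \<in> borel_measurable \<mu>"
    and bounded_f: "\<exists>K. \<forall>x\<in>space \<mu>. \<bar>f x\<bar> \<le> K"

definition obs :: "('o \<Rightarrow> 'x \<Rightarrow> 'x) \<Rightarrow> ('x \<Rightarrow> real) \<Rightarrow> nat \<Rightarrow> (nat \<Rightarrow> 'o) \<Rightarrow> 'x \<Rightarrow> real" where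
  "obs T f i \<omega> = f \<circ> phi T i \<omega>"

definition centred_obs ::
    "'x measure \<Rightarrow> ('o \<Rightarrow> 'x \<Rightarrow> 'x) \<Rightarrow> ('x \<Rightarrow> real) \<Rightarrow> nat \<Rightarrow> (nat \<Rightarrow> 'o) \<Rightarrow> 'x \<Rightarrow> real" where
  "centred_obs \<mu> T f i \<omega> x = obs T f i \<omega> x - (\<integral>y. obs T f i \<omega> y \<partial>\<mu>)"

definition sigma_n_sq ::
    "'x measure \<Rightarrow> ('o \<Rightarrow> 'x \<Rightarrow> 'x) \<Rightarrow> ('x \<Rightarrow> real) \<Rightarrow> nat \<Rightarrow> (nat \<Rightarrow> 'o) \<Rightarrow> real" where
  "sigma_n_sq \<mu> T f n \<omega> =
     1 / real n * (\<Sum>i<n. \<Sum>j<n. \<integral>x. centred_obs \<mu> T f i \<omega> x * centred_obs \<mu> T f j \<omega> x \<partial>\<mu>)"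

definition SA1 :: "(nat \<Rightarrow> 'o) measure \<Rightarrow> 'x measure \<Rightarrow> ('o \<Rightarrow> 'x \<Rightarrow> 'x) \<Rightarrow> ('x \<Rightarrow> real) \<Rightarrow>
    (nat \<Rightarrow> real) \<Rightarrow> bool" where
  "SA1 P \<mu> T f \<eta> \<longleftrightarrow>
     antimono \<eta> \<and> (\<forall>n. 0 \<le> \<eta> n) \<and> summable \<eta> \<and>
     (AE \<omega> in P. \<forall>i j.
        \<bar>\<integral>x. centred_obs \<mu> T f i \<omega> x * centred_obs \<mu> T f j \<omega> x \<partial>\<mu>\<bar> \<le> \<eta> (nat \<bar>int i - int j\<bar>))"

definition coord_sigma :: "'o measure \<Rightarrow> nat set \<Rightarrow> (nat \<Rightarrow> 'o) set set" where
  "coord_sigma M0 I = sigma_sets (space (seq_space M0))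
     {(\<lambda>\<omega>. \<omega> m) -` A \<inter> space (seq_space M0) | m A. m \<in> I \<and> A \<in> sets M0}"

definition SA2 :: "'o measure \<Rightarrow> (nat \<Rightarrow> 'o) measure \<Rightarrow> (nat \<Rightarrow> real) \<Rightarrow> bool" where
  "SA2 M0 P \<alpha> \<longleftrightarrow>
     (\<forall>m n. 1 \<le> m \<longrightarrow> m \<le> n \<longrightarrow> \<alpha> n \<le> \<alpha> m) \<and> \<alpha> \<longlonglongrightarrow> 0 \<and>
     (\<forall>n\<ge>1. \<forall>i\<ge>1. \<forall>A\<in>coord_sigma M0 {1..i}. \<forall>B\<in>coord_sigma M0 {i + n..}.
        \<bar>measure P (A \<inter> B) - measure P A * measure P B\<bar> \<le> \<alpha> n)"

definition SA3 :: "(nat \<Rightarrow> 'o) measure \<Rightarrow> 'x measure \<Rightarrow> ('o \<Rightarrow> 'x \<Rightarrow> 'x) \<Rightarrow> ('x \<Rightarrow> real) \<Rightarrow>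
    (nat \<Rightarrow> real) \<Rightarrow> bool" where
  "SA3 P \<mu> T f \<eta> \<longleftrightarrow>
     (\<exists>C\<ge>0. AE \<omega> in P. \<forall>k. \<forall>r\<le>k.
        \<forall>g \<in> range (\<lambda>m. obs T f m ((shift ^^ k) \<omega>)) \<union>
              range (\<lambda>m x. f x * obs T f m ((shift ^^ k) \<omega>) x).
          \<bar>(\<integral>x. g (phi T k \<omega> x) \<partial>\<mu>) - (\<integral>x. g (phi T (k - r) ((shift ^^ r) \<omega>) x) \<partial>\<mu>)\<bar>
            \<le> C * \<eta> (k - r))"

definition asymp_mean_stationary ::
    "'o measure \<Rightarrow> (nat \<Rightarrow> 'o) measure \<Rightarrow> (nat \<Rightarrow> 'o) measure \<Rightarrow> bool" where
  "asymp_mean_stationary M0 P Pbar \<longleftrightarrow>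
     prob_space Pbar \<and> sets Pbar = sets (seq_space M0) \<and>
     (\<forall>g :: (nat \<Rightarrow> 'o) \<Rightarrow> real.
        g \<in> borel_measurable (seq_space M0) \<longrightarrow>
        (\<exists>K. \<forall>\<omega>\<in>space (seq_space M0). \<bar>g \<omega>\<bar> \<le> K) \<longrightarrow>
        (\<lambda>n. 1 / real n * (\<Sum>i<n. \<integral>\<omega>. g ((shift ^^ i) \<omega>) \<partial>P)) \<longlonglongrightarrow> (\<integral>\<omega>. g \<omega> \<partial>Pbar))"

definition g1 :: "'x measure \<Rightarrow> ('o \<Rightarrow> 'x \<Rightarrow> 'x) \<Rightarrow> ('x \<Rightarrow> real) \<Rightarrow> nat \<Rightarrow> nat \<Rightarrow>
    (nat \<Rightarrow> 'o) \<Rightarrow> real" where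
  "g1 \<mu> T f r k \<omega> = (\<integral>x. obs T f r \<omega> x * obs T f (r + k) \<omega> x \<partial>\<mu>)"

definition g2 :: "'x measure \<Rightarrow> ('o \<Rightarrow> 'x \<Rightarrow> 'x) \<Rightarrow> ('x \<Rightarrow> real) \<Rightarrow> nat \<Rightarrow> nat \<Rightarrow>
    (nat \<Rightarrow> 'o) \<Rightarrow> real" where
  "g2 \<mu> T f r k \<omega> = (\<integral>x. obs T f r \<omega> x \<partial>\<mu>) * (\<integral>x. obs T f (r + k) \<omega> x \<partial>\<mu>)"

definition SA4 :: "'o measure \<Rightarrow> (nat \<Rightarrow> 'o) measure \<Rightarrow> (nat \<Rightarrow> 'o) measure \<Rightarrow> 'x measure \<Rightarrow>
    ('o \<Rightarrow> 'x \<Rightarrow> 'x) \<Rightarrow> ('x \<Rightarrow> real) \<Rightarrow> real \<Rightarrow> bool" where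
  "SA4 M0 P Pbar \<mu> T f \<zeta> \<longleftrightarrow>
     asymp_mean_stationary M0 P Pbar \<and>
     (\<exists>C0>0. \<forall>n\<ge>1. \<forall>r k. \<forall>g \<in> {g1 \<mu> T f r k, g2 \<mu> T f r k}.
        \<bar>1 / real n * (\<Sum>i<n. \<integral>\<omega>. g ((shift ^^ i) \<omega>) \<partial>P) - (\<integral>\<omega>. g \<omega> \<partial>Pbar)\<bar>
          \<le> C0 * real n powr (- \<zeta>))"

text \<open>The case distinction implements \<open>0 powr (- \<psi>) = 1\<close>, whereas \<open>0 powr a = 0\<close> in the library.\<close>

definition poly_rate :: "real \<Rightarrow> real \<Rightarrow> nat \<Rightarrow> real" where
  "poly_rate A \<psi> n = A * (if n = 0 then 1 else real n powr (- \<psi>))"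

definition mean_cov :: "(nat \<Rightarrow> 'o) measure \<Rightarrow> 'x measure \<Rightarrow> ('o \<Rightarrow> 'x \<Rightarrow> 'x) \<Rightarrow> ('x \<Rightarrow> real) \<Rightarrow>
    nat \<Rightarrow> nat \<Rightarrow> real" where
  "mean_cov Pbar \<mu> T f k i = (\<integral>\<omega>. g1 \<mu> T f i k \<omega> - g2 \<mu> T f i k \<omega> \<partial>Pbar)"

text \<open>Meaningful only if the limits exist and the series converges.\<close>

definition sigma_sq_term :: "(nat \<Rightarrow> 'o) measure \<Rightarrow> 'x measure \<Rightarrow> ('o \<Rightarrow> 'x \<Rightarrow> 'x) \<Rightarrow>
    ('x \<Rightarrow> real) \<Rightarrow> nat \<Rightarrow> real" where
  "sigma_sq_term Pbar \<mu> T f k = (2 - (if k = 0 then 1 else 0)) * lim (mean_cov Pbar \<mu> T f k)"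

definition sigma_sq :: "(nat \<Rightarrow> 'o) measure \<Rightarrow> 'x measure \<Rightarrow> ('o \<Rightarrow> 'x \<Rightarrow> 'x) \<Rightarrow>
    ('x \<Rightarrow> real) \<Rightarrow> real" where
  "sigma_sq Pbar \<mu> T f = (\<Sum>k. sigma_sq_term Pbar \<mu> T f k)"

definition Delta :: "(nat \<Rightarrow> 'o) measure \<Rightarrow> 'x measure \<Rightarrow> ('o \<Rightarrow> 'x \<Rightarrow> 'x) \<Rightarrow> ('x \<Rightarrow> real) \<Rightarrow>
    (nat \<Rightarrow> 'o) \<Rightarrow> nat \<Rightarrow> real" where
  "Delta Pbar \<mu> T f \<omega> n = \<bar>sigma_n_sq \<mu> T f n \<omega> - sigma_sq Pbar \<mu> T f\<bar>"

end

theory Submission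
  imports "HOL-Real_Asymp.Real_Asymp" Defs
begin

text \<open>
  Write \<open>c i k\<close> for the covariance of \<open>f\<^sub>i\<close> and \<open>f\<^sub>i\<^sub>+\<^sub>k\<close> under \<open>\<mu>\<close>, and fold the covariance matrix along its
  diagonal: \<open>w j = c j 0 + 2 * (\<Sum>i<j. c i (j - i))\<close>. Then \<open>n * \<sigma>\<^sub>n\<^sup>2 = w 0 + \<dots> + w (n - 1)\<close> holds
  exactly, and \<open>w j\<close> depends on the first \<open>j\<close> coordinates of \<open>\<omega>\<close> only. The distance of \<open>\<sigma>\<^sub>n\<^sup>2\<close> from \<open>\<sigma>\<^sup>2\<close>
  is therefore at most a fluctuation, the average of \<open>w j - E (w j)\<close> over \<open>j < n\<close>, plus the distance
  of the average of \<open>E (w j)\<close> from \<open>\<sigma>\<^sup>2\<close>.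

  Fluctuation. In \<open>w (i + d)\<close> the entries far from the diagonal are negligible by \<open>SA1\<close>, and by
  \<open>SA3\<close> the remaining entries hardly change when the composition is started later. So \<open>w (i + d)\<close> is
  within \<open>O(d powr (1 - \<psi>))\<close> of a function of coordinates that lie a fixed fraction of \<open>d\<close> beyond \<open>i\<close>,
  and \<open>SA2\<close> yields covariances of order \<open>d powr (- m)\<close> with \<open>m = min (\<psi> - 1) \<gamma>\<close>
  (\<open>covariance_decay\<close>). Sums of \<open>n\<close> consecutive centred \<open>w j\<close>
  then have variance \<open>O(n powr (2 - m'))\<close>, where \<open>m' = 1\<close> if \<open>m > 1\<close>, \<open>m' = m\<close> if \<open>m < 1\<close>, and \<open>m'\<close> is
  slightly below \<open>1\<close> if \<open>m = 1\<close>, where the harmonic series costs a logarithm. The almost sure rate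
  follows by the method of Rademacher, Menshov, Gal and Koksma (\<open>gal_koksma\<close>).

  Mean. The expectation of \<open>c (r + i) k\<close> differs from that of \<open>c r k\<close> after \<open>i\<close> shifts by \<open>O(\<eta> r)\<close>,
  again by \<open>SA3\<close>, and averages of the latter over \<open>i\<close> converge with rate \<open>\<zeta>\<close> to the mean under
  the stationary measure by \<open>SA4\<close>. Comparing two values of \<open>r\<close> with the same long averages shows that these
  stationary means form a Cauchy sequence in \<open>r\<close>. Cutting the series over \<open>k\<close> at \<open>K\<close> and taking
  \<open>r = K\<close> costs \<open>K * n powr (- \<zeta>) + K powr (1 - \<psi>)\<close> if \<open>\<zeta> \<le> 1\<close>, which \<open>K = n powr (\<zeta> / \<psi>)\<close> balances
  (\<open>weighted_average_bigo\<close>). For \<open>\<zeta> \<ge> 1\<close> the argument runs with \<open>1\<close> in place of \<open>\<zeta>\<close>, and the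
  resulting \<open>n powr (1 / \<psi> - 1)\<close> is dominated by the bound on the fluctuation because
  \<open>1 - 1 / \<psi> \<ge> min 1 (\<psi> - 1) / 2\<close>. Nonnegativity of \<open>\<sigma>\<^sup>2\<close> is inherited from \<open>\<sigma>\<^sub>n\<^sup>2\<close>.
\<close>

section \<open>A strong law with rate from block variances\<close>

text \<open>
  The squared block sums of \<open>x\<close> over all dyadic subintervals of \<open>{M..<M + 2 ^ s}\<close>, as in the
  Rademacher--Menshov inequality.
\<close>
primrec dyadic_energy :: "(nat \<Rightarrow> real) \<Rightarrow> nat \<Rightarrow> nat \<Rightarrow> real" where
  "dyadic_energy x 0 M = (x M)\<^sup>2"
| "dyadic_energy x (Suc s) M =
     (\<Sum>i\<in>{M..<M + 2 ^ Suc s}. x i)\<^sup>2 + dyadic_energy x s M + dyadic_energy x s (M + 2 ^ s)"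

lemma dyadic_energy_nonneg: "0 \<le> dyadic_energy x s M"
proof (induction s arbitrary: M)
  case (Suc s)
  then show ?case by (simp only: dyadic_energy.simps) (intro add_nonneg_nonneg zero_le_power2 Suc.IH)
qed simp

lemma full_block_le_dyadic_energy: "(\<Sum>i\<in>{M..<M + 2 ^ s}. x i)\<^sup>2 \<le> dyadic_energy x s M"
  by (cases s) (auto simp: dyadic_energy_nonneg intro: add_nonneg_nonneg)

text \<open>
  The deterministic core of the Rademacher--Menshov maximal inequality. An initial block that is
  longer than half of the interval consists of the left half, which is itself one of the dyadic
  blocks, and an initial block of the right half.
\<close>
lemma initial_block_le_dyadic_energy:
  assumes "n \<le> 2 ^ s"
  shows "(\<Sum>i\<in>{M..<M + n}. x i)\<^sup>2 \<le> (real s + 1) * dyadic_energy x s M"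
  using assms
proof (induction s arbitrary: M n)
  case 0
  then consider "n = 0" | "n = 1" by force
  then show ?case by cases auto
next
  case (Suc s)
  let ?D = "dyadic_energy x"
  have split: "?D s M + ?D s (M + 2 ^ s) \<le> ?D (Suc s) M" by simp
  show ?case
  proof (cases "n \<le> 2 ^ s")
    case True
    have "(\<Sum>i\<in>{M..<M + n}. x i)\<^sup>2 \<le> (real s + 1) * ?D s M" using Suc.IH True by blast
    also have "\<dots> \<le> (real (Suc s) + 1) * ?D (Suc s) M"
      using split dyadic_energy_nonneg[of x s]
      by (intro mult_mono) (auto intro: order_trans[OF _ split] add_nonneg_nonneg)
    finally show ?thesis .
  next
    case False
    define a where "a = (\<Sum>i\<in>{M..<M + 2 ^ s}. x i)"
    define b where "b = (\<Sum>i\<in>{M + 2 ^ s..<M + 2 ^ s + (n - 2 ^ s)}. x i)"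
    have ab: "(\<Sum>i\<in>{M..<M + n}. x i) = a + b"
      unfolding a_def b_def using False by (subst sum.atLeastLessThan_concat) auto
    have a2: "a\<^sup>2 \<le> ?D s M" unfolding a_def by (rule full_block_le_dyadic_energy)
    have b2: "b\<^sup>2 \<le> (real s + 1) * ?D s (M + 2 ^ s)"
      unfolding b_def using Suc.prems False by (intro Suc.IH) auto
    define t where "t = real s + 1"
    have t: "t > 0" by (simp add: t_def)
    \<comment> \<open>The inequality of Young with weight \<open>t = s + 1\<close> lets the factor grow by exactly one per scale.\<close>
    have "0 \<le> (t * a - b)\<^sup>2" by simp
    then have "t * (a + b)\<^sup>2 \<le> t * ((1 + t) * a\<^sup>2) + (1 + t) * b\<^sup>2"
      by (simp add: power2_eq_square algebra_simps)
    also have "\<dots> \<le> t * ((1 + t) * ?D s M) + (1 + t) * (t * ?D s (M + 2 ^ s))"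
      using a2 b2 t by (intro add_mono mult_left_mono) (auto simp: t_def)
    also have "\<dots> = t * ((1 + t) * (?D s M + ?D s (M + 2 ^ s)))" by (simp add: algebra_simps)
    also have "\<dots> \<le> t * ((1 + t) * ?D (Suc s) M)"
      using split t by (intro mult_left_mono) auto
    finally have "(a + b)\<^sup>2 \<le> (1 + t) * ?D (Suc s) M" using t by simp
    then show ?thesis unfolding ab t_def by (simp add: algebra_simps)
  qed
qed


text \<open>
  Each of the \<open>s + 1\<close> scales costs at most \<open>C * (2 ^ s) powr p\<close>: for \<open>p \<ge> 1\<close>, joining two blocks
  does not lower the bound.
\<close>
lemma dyadic_energy_expectation:
  fixes X :: "nat \<Rightarrow> 'a \<Rightarrow> real" and C p :: real
  assumes int: "\<And>m n. integrable N (\<lambda>\<omega>. (\<Sum>i\<in>{m..<m + n}. X i \<omega>)\<^sup>2)"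
    and moment: "\<And>m n. n \<ge> 1 \<Longrightarrow> (\<integral>\<omega>. (\<Sum>i\<in>{m..<m + n}. X i \<omega>)\<^sup>2 \<partial>N) \<le> C * real n powr p"
    and p: "p \<ge> 1" and C: "C \<ge> 0"
  shows "integrable N (\<lambda>\<omega>. dyadic_energy (\<lambda>i. X i \<omega>) s m) \<and>
    (\<integral>\<omega>. dyadic_energy (\<lambda>i. X i \<omega>) s m \<partial>N) \<le> (real s + 1) * C * (2 ^ s) powr p"
proof (induction s arbitrary: m)
  case 0
  show ?case using int[of m 1] moment[of 1 m] by simp
next
  case (Suc s)
  let ?D = "\<lambda>s m \<omega>. dyadic_energy (\<lambda>i. X i \<omega>) s m"
  have i: "integrable N (?D s m)" for m using Suc.IH by blast
  have "(\<integral>\<omega>. ?D (Suc s) m \<omega> \<partial>N) =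
      (\<integral>\<omega>. (\<Sum>i\<in>{m..<m + 2 ^ Suc s}. X i \<omega>)\<^sup>2 \<partial>N) + (\<integral>\<omega>. ?D s m \<omega> \<partial>N)
      + (\<integral>\<omega>. ?D s (m + 2 ^ s) \<omega> \<partial>N)"
    unfolding dyadic_energy.simps
    by (simp only: Bochner_Integration.integral_add int i Bochner_Integration.integrable_add)
  also have "\<dots> \<le> C * (2 ^ Suc s) powr p + (real s + 1) * C * (2 ^ s) powr p
      + (real s + 1) * C * (2 ^ s) powr p"
    using moment[of "2 ^ Suc s" m] Suc.IH by (intro add_mono) auto
  also have "\<dots> = C * (2 ^ Suc s) powr p + (real s + 1) * C * (2 * (2 ^ s) powr p)"
    by (simp add: algebra_simps)
  also have "\<dots> \<le> C * (2 ^ Suc s) powr p + (real s + 1) * C * (2 ^ Suc s) powr p"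
  proof -
    have "2 * (2 ^ s) powr p \<le> (2::real) powr p * (2 ^ s) powr p"
      using powr_mono[of 1 p 2] p by (intro mult_right_mono) auto
    also have "\<dots> = (2 ^ Suc s) powr p" by (simp add: powr_mult)
    finally show ?thesis using C by (intro add_left_mono mult_left_mono) auto
  qed
  finally have "(\<integral>\<omega>. ?D (Suc s) m \<omega> \<partial>N) \<le> (real (Suc s) + 1) * C * (2 ^ Suc s) powr p"
    by (simp add: algebra_simps)
  moreover have "integrable N (?D (Suc s) m)"
    unfolding dyadic_energy.simps by (intro Bochner_Integration.integrable_add int i)
  ultimately show ?case by blast
qed

text \<open>
  The exponent of the logarithm is half of \<open>3 + 2 * \<delta>\<close>: one factor \<open>s + 1\<close> is lost in the maximal
  inequality, and the energy itself carries \<open>2 + 2 * \<delta>\<close>.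
\<close>
lemma partial_sums_bigo_of_dyadic_energy:
  fixes x :: "nat \<Rightarrow> real"
  assumes K: "\<And>s. dyadic_energy x s 0 \<le> K * ((2 ^ s) powr p * (real s + 1) powr (2 + 2 * \<delta>))"
    and p: "p \<ge> 0" and \<delta>: "\<delta> > 0"
  shows "(\<lambda>n. \<Sum>i<n. x i) \<in> O(\<lambda>n. real n powr (p / 2) * ln (real n) powr (3 / 2 + \<delta>))"
proof -
  define c where "c = 3 / ln (2::real)"
  have c: "c > 0" by (simp add: c_def)
  have K0: "K \<ge> 0" using K[of 0] order_trans[OF dyadic_energy_nonneg K[of 0]] by simp
  define K' where "K' = K * 2 powr p * c powr (3 + 2 * \<delta>)"
  have K'0: "K' \<ge> 0" using K0 by (simp add: K'_def)
  have bound: "\<bar>\<Sum>i<n. x i\<bar> \<le> sqrt K' * (real n powr (p / 2) * ln (real n) powr (3 / 2 + \<delta>))"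
    if n: "n \<ge> 2" for n
  proof -
    obtain s where s: "2 ^ s \<le> n" "n < 2 ^ Suc s"
      using ex_power_ivl1[of 2 n] n by auto
    have sr: "(2::real) ^ s \<le> real n" using s(1) by (metis of_nat_le_iff of_nat_numeral of_nat_power)
    have "real s * ln 2 \<le> ln (real n)"
      using sr n by (simp add: ln_realpow[symmetric])
    moreover have "ln 2 \<le> ln (real n)" using n by simp
    ultimately have "(real s + 2) * ln 2 \<le> 3 * ln (real n)" by (simp add: algebra_simps)
    then have s_le: "real s + 2 \<le> c * ln (real n)" by (simp add: c_def field_simps)
    have lnn: "ln (real n) > 0" using n by simp
    have "(\<Sum>i<n. x i)\<^sup>2 \<le> (real (Suc s) + 1) * dyadic_energy x (Suc s) 0"
      using initial_block_le_dyadic_energy[of n "Suc s" x 0] s(2) by (simp add: atLeast0LessThan)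
    also have "\<dots> \<le> (real s + 2) * (K * ((2 ^ Suc s) powr p * (real s + 2) powr (2 + 2 * \<delta>)))"
      using K[of "Suc s"]
      by (intro mult_mono)
        (auto simp: dyadic_energy_nonneg add.commute simp del: power_Suc dyadic_energy.simps)
    also have "\<dots> = K * ((2 ^ Suc s) powr p * (real s + 2) powr (3 + 2 * \<delta>))"
    proof -
      have "(real s + 2) powr (3 + 2 * \<delta>) = (real s + 2) powr (1 + (2 + 2 * \<delta>))"
        by (rule arg_cong) simp
      also have "\<dots> = (real s + 2) * (real s + 2) powr (2 + 2 * \<delta>)" by (subst powr_add) simp
      finally show ?thesis by simp
    qed
    also have "\<dots> \<le> K * ((2 * real n) powr p * (c * ln (real n)) powr (3 + 2 * \<delta>))"
      using K0 sr p \<delta> s_le by (intro mult_left_mono mult_mono powr_mono2) auto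
    also have "\<dots> = K' * (real n powr p * ln (real n) powr (3 + 2 * \<delta>))"
      using c lnn by (simp add: K'_def powr_mult)
    also have "\<dots> = (sqrt K' * (real n powr (p / 2) * ln (real n) powr (3 / 2 + \<delta>)))\<^sup>2"
      using K'0 lnn n by (simp add: power_mult_distrib powr_power algebra_simps)
    finally have "\<bar>\<Sum>i<n. x i\<bar> \<le> \<bar>sqrt K' * (real n powr (p / 2) * ln (real n) powr (3 / 2 + \<delta>))\<bar>"
      by (simp only: abs_le_square_iff)
    then show ?thesis using K'0 by (simp add: abs_mult)
  qed
  show ?thesis
    by (rule bigoI[of _ "sqrt K'"])
       (use bound in \<open>auto intro!: eventually_at_top_linorderI[of 2]\<close>)
qed

text \<open>
  A strong law of Gal and Koksma. The energy at scale \<open>s\<close> has expectation of order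
  \<open>(s + 1) * (2 ^ s) powr p\<close>; divided by \<open>(2 ^ s) powr p * (s + 1) powr (2 + 2 * \<delta>)\<close> these expectations
  are summable. Hence the divided energies are almost surely summable, in particular bounded.
\<close>
theorem gal_koksma:
  fixes X :: "nat \<Rightarrow> 'a \<Rightarrow> real" and C p \<delta> :: real
  assumes int: "\<And>m n. integrable N (\<lambda>\<omega>. (\<Sum>i\<in>{m..<m + n}. X i \<omega>)\<^sup>2)"
    and moment: "\<And>m n. n \<ge> 1 \<Longrightarrow> (\<integral>\<omega>. (\<Sum>i\<in>{m..<m + n}. X i \<omega>)\<^sup>2 \<partial>N) \<le> C * real n powr p"
    and p: "p \<ge> 1" and \<delta>: "\<delta> > 0"
  shows "AE \<omega> in N. (\<lambda>n. \<Sum>i<n. X i \<omega>) \<in> O(\<lambda>n. real n powr (p / 2) * ln (real n) powr (3 / 2 + \<delta>))"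
proof -
  have C: "C \<ge> 0"
    using moment[of 1 0] order_trans[OF _ moment[of 1 0], of 0] by (simp add: integral_nonneg_AE)
  let ?D = "\<lambda>s \<omega>. dyadic_energy (\<lambda>i. X i \<omega>) s 0"
  define W where "W s = (2 ^ s) powr p * (real s + 1) powr (2 + 2 * \<delta>)" for s :: nat
  have W: "W s > 0" for s by (simp add: W_def)
  have int_D: "integrable N (?D s)" and mom_D: "(\<integral>\<omega>. ?D s \<omega> \<partial>N) \<le> (real s + 1) * C * (2 ^ s) powr p" for s
    using dyadic_energy_expectation[OF int moment p C] by blast+
  have mom: "(\<integral>\<omega>. ?D s \<omega> / W s \<partial>N) \<le> C * (real (Suc s) powr (- 1 - 2 * \<delta>))" for s
  proof -
    have "(\<integral>\<omega>. ?D s \<omega> / W s \<partial>N) \<le> (real s + 1) * C * (2 ^ s) powr p / W s"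
      using mom_D[of s] W[of s] by (simp add: divide_right_mono)
    also have "\<dots> = C * ((real s + 1) powr 1 / (real s + 1) powr (2 + 2 * \<delta>))"
      by (simp add: W_def)
    also have "\<dots> = C * (real (Suc s) powr (- 1 - 2 * \<delta>))"
      by (subst powr_diff[symmetric]) (simp add: add.commute)
    finally show ?thesis .
  qed
  have summ: "summable (\<lambda>s. \<integral>\<omega>. ?D s \<omega> / W s \<partial>N)"
  proof (rule summable_comparison_test')
    show "summable (\<lambda>s. C * (real (Suc s) powr (- 1 - 2 * \<delta>)))"
      using \<delta> summable_Suc_iff[of "\<lambda>n. real n powr (- 1 - 2 * \<delta>)"]
      by (intro summable_mult) (simp add: summable_real_powr_iff)
    show "norm (\<integral>\<omega>. ?D s \<omega> / W s \<partial>N) \<le> C * (real (Suc s) powr (- 1 - 2 * \<delta>))" if "s \<ge> 0" for s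
    proof -
      have "0 \<le> (\<integral>\<omega>. ?D s \<omega> / W s \<partial>N)"
        using W[of s] by (intro integral_nonneg_AE) (auto simp: dyadic_energy_nonneg)
      then show ?thesis using mom[of s] by simp
    qed
  qed
  have "(\<integral>\<^sup>+\<omega>. (\<Sum>s. ennreal (?D s \<omega> / W s)) \<partial>N) = (\<Sum>s. \<integral>\<^sup>+\<omega>. ennreal (?D s \<omega> / W s) \<partial>N)"
    using int_D
    by (intro nn_integral_suminf)
      (auto intro!: measurable_compose[OF borel_measurable_divide measurable_ennreal])
  also have "\<dots> = (\<Sum>s. ennreal (\<integral>\<omega>. ?D s \<omega> / W s \<partial>N))"
    using int_D W by (intro suminf_cong nn_integral_eq_integral)
      (auto simp: dyadic_energy_nonneg less_imp_le)
  also have "\<dots> \<noteq> \<infinity>"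
    unfolding infinity_ennreal_def using W
    by (intro ennreal_suminf_neq_top summ integral_nonneg_AE) (auto simp: dyadic_energy_nonneg less_imp_le)
  finally have "AE \<omega> in N. (\<Sum>s. ennreal (?D s \<omega> / W s)) \<noteq> \<infinity>"
    using int_D
    by (intro nn_integral_noteq_infinite)
      (auto intro!: borel_measurable_suminf
        measurable_compose[OF borel_measurable_divide measurable_ennreal])
  then show ?thesis
  proof eventually_elim
    case (elim \<omega>)
    have "summable (\<lambda>s. ?D s \<omega> / W s)"
      using elim W by (intro summable_suminf_not_top) (auto simp: dyadic_energy_nonneg less_imp_le)
    then have "Bseq (\<lambda>s. ?D s \<omega> / W s)"
      by (intro convergent_imp_Bseq convergentI[OF summable_LIMSEQ_zero])
    then obtain K where K: "\<And>s. norm (?D s \<omega> / W s) \<le> K" by (auto simp: Bseq_def)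
    have "?D s \<omega> \<le> K * W s" for s
      using K[of s] W[of s] by (simp add: dyadic_energy_nonneg field_simps)
    then have "?D s \<omega> \<le> K * ((2 ^ s) powr p * (real s + 1) powr (2 + 2 * \<delta>))" for s
      unfolding W_def .
    then show ?case using p \<delta> by (intro partial_sums_bigo_of_dyadic_energy) auto
  qed
qed

section \<open>Covariances under mixing\<close>

text \<open>
  A function with values in the unit interval is, up to \<open>1 / N\<close>, the average of the indicators of \<open>N\<close>
  of its level sets. This transfers a mixing bound from events to functions.
\<close>
lemma staircase_approx:
  fixes x :: real
  assumes x: "0 \<le> x" "x \<le> 1" and N: "N \<ge> 1"
  shows "\<bar>(\<Sum>l=1..N. of_bool (real l / real N \<le> x)) / real N - x\<bar> \<le> 1 / real N"
proof -
  define z where "z = real N * x"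
  define m where "m = nat \<lfloor>z\<rfloor>"
  have N0: "real N > 0" using N by simp
  have z: "0 \<le> z" unfolding z_def using x by simp
  have zN: "z \<le> real N" unfolding z_def by (rule mult_left_le) (use x in auto)
  from z have m: "real m \<le> z" "z < real m + 1" unfolding m_def by linarith+
  have m_le: "m \<le> N" using m(1) zN by linarith
  have level: "real l / real N \<le> x \<longleftrightarrow> l \<le> m" for l
  proof -
    have "real l / real N \<le> x \<longleftrightarrow> real l \<le> z"
      unfolding z_def using N0 by (simp add: pos_divide_le_eq mult.commute)
    also have "\<dots> \<longleftrightarrow> l \<le> m" using m by linarith
    finally show ?thesis .
  qed
  have set_eq: "{1..N} \<inter> {l. real l / real N \<le> x} = {1..m}" unfolding level using m_le by auto
  have "(\<Sum>l=1..N. of_bool (real l / real N \<le> x)) = real (card {1..m})"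
    by (subst sum_of_bool_eq) (rule finite_atLeastAtMost, rule arg_cong[OF set_eq])
  then have eq: "(\<Sum>l=1..N. of_bool (real l / real N \<le> x)) = real m" by simp
  have "real m / real N - x = (real m - z) / real N"
    unfolding z_def using N0 by (simp add: diff_divide_distrib)
  then have "\<bar>real m / real N - x\<bar> = \<bar>real m - z\<bar> / real N" using N0 by (simp only: abs_divide abs_of_pos)
  also have "\<dots> \<le> 1 / real N" using m by (intro divide_right_mono) auto
  finally show ?thesis unfolding eq .
qed

lemma (in prob_space) integral_diff_le:
  fixes U V :: "'a \<Rightarrow> real"
  assumes "integrable M U" "integrable M V" "AE \<omega> in M. \<bar>U \<omega> - V \<omega>\<bar> \<le> e"
  shows "\<bar>(\<integral>\<omega>. U \<omega> \<partial>M) - (\<integral>\<omega>. V \<omega> \<partial>M)\<bar> \<le> e"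
proof -
  have "\<bar>(\<integral>\<omega>. U \<omega> \<partial>M) - (\<integral>\<omega>. V \<omega> \<partial>M)\<bar> = \<bar>\<integral>\<omega>. U \<omega> - V \<omega> \<partial>M\<bar>"
    using assms by simp
  also have "\<dots> \<le> (\<integral>\<omega>. \<bar>U \<omega> - V \<omega>\<bar> \<partial>M)" by (rule integral_abs_bound)
  also have "\<dots> \<le> (\<integral>\<omega>. e \<partial>M)" using assms by (intro integral_mono_AE) auto
  finally show ?thesis by (simp add: prob_space)
qed

text \<open>
  The covariance of two staircase functions is an average of mixing defects over pairs of levels,
  hence at most \<open>a\<close> whatever the number \<open>N\<close> of steps.
\<close>
lemma (in prob_space) covariance_le_level_set_mixing_unit:
  fixes X Y :: "'a \<Rightarrow> real"
  assumes [measurable]: "X \<in> borel_measurable M" "Y \<in> borel_measurable M"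
    and X: "AE \<omega> in M. 0 \<le> X \<omega> \<and> X \<omega> \<le> 1" and Y: "AE \<omega> in M. 0 \<le> Y \<omega> \<and> Y \<omega> \<le> 1"
    and mix: "\<And>s t. \<bar>prob ({\<omega>\<in>space M. s \<le> X \<omega>} \<inter> {\<omega>\<in>space M. t \<le> Y \<omega>})
        - prob {\<omega>\<in>space M. s \<le> X \<omega>} * prob {\<omega>\<in>space M. t \<le> Y \<omega>}\<bar> \<le> a"
  shows "\<bar>(\<integral>\<omega>. X \<omega> * Y \<omega> \<partial>M) - (\<integral>\<omega>. X \<omega> \<partial>M) * (\<integral>\<omega>. Y \<omega> \<partial>M)\<bar> \<le> a"
proof -
  have bnd: "\<bar>(\<integral>\<omega>. X \<omega> * Y \<omega> \<partial>M) - (\<integral>\<omega>. X \<omega> \<partial>M) * (\<integral>\<omega>. Y \<omega> \<partial>M)\<bar> \<le> a + 4 * (1 / real N)" if N: "N \<ge> 1" for N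
  proof -
    define Q where "Q = (\<lambda>Z \<omega>. (\<Sum>l=1..N. indicator {\<omega>\<in>space M. real l / real N \<le> Z \<omega>} \<omega>) / real N :: real)"
    define e where "e = 1 / real N"
    have [measurable]: "Q Z \<in> borel_measurable M" if [measurable]: "Z \<in> borel_measurable M" for Z
      unfolding Q_def by measurable
    have Q01: "0 \<le> Q Z \<omega> \<and> Q Z \<omega> \<le> 1" for Z \<omega>
    proof -
      have "(\<Sum>l=1..N. indicator {\<omega>\<in>space M. real l / real N \<le> Z \<omega>} \<omega>) \<le> (\<Sum>l=1..N. 1::real)"
        by (intro sum_mono) (auto simp: indicator_def)
      then show ?thesis using N by (auto simp: Q_def sum_nonneg)
    qed
    have approx: "AE \<omega> in M. \<bar>Z \<omega> - Q Z \<omega>\<bar> \<le> e" if "AE \<omega> in M. 0 \<le> Z \<omega> \<and> Z \<omega> \<le> 1" for Z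
      using that AE_space
    proof eventually_elim
      case (elim \<omega>)
      have "Q Z \<omega> = (\<Sum>l=1..N. of_bool (real l / real N \<le> Z \<omega>)) / real N"
        using elim(2) by (simp add: Q_def indicator_def of_bool_def)
      then show ?case using staircase_approx[of "Z \<omega>" N] elim(1) N by (simp add: e_def abs_minus_commute)
    qed
    have iX: "integrable M X" by (rule integrable_const_bound[where B=1]) (use X in \<open>auto elim: eventually_mono\<close>)
    have iY: "integrable M Y" by (rule integrable_const_bound[where B=1]) (use Y in \<open>auto elim: eventually_mono\<close>)
    have iXY: "integrable M (\<lambda>\<omega>. X \<omega> * Y \<omega>)"
    proof (rule integrable_const_bound[where B=1])
      show "AE \<omega> in M. norm (X \<omega> * Y \<omega>) \<le> 1"
        using X Y by eventually_elim (simp add: abs_mult mult_le_one)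
    qed simp
    have iQX: "integrable M (Q X)" by (rule integrable_const_bound[where B=1]) (use Q01[of X] in auto)
    have iQY: "integrable M (Q Y)" by (rule integrable_const_bound[where B=1]) (use Q01[of Y] in auto)
    have iQQ: "integrable M (\<lambda>\<omega>. Q X \<omega> * Q Y \<omega>)"
      by (rule integrable_const_bound[where B=1]) (use Q01 in \<open>auto simp: abs_mult intro!: mult_le_one\<close>)
    have d1: "\<bar>(\<integral>\<omega>. X \<omega> * Y \<omega> \<partial>M) - (\<integral>\<omega>. Q X \<omega> * Q Y \<omega> \<partial>M)\<bar> \<le> 2 * e"
    proof (rule integral_diff_le[OF iXY iQQ])
      show "AE \<omega> in M. \<bar>X \<omega> * Y \<omega> - Q X \<omega> * Q Y \<omega>\<bar> \<le> 2 * e"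
        using X approx[OF X] approx[OF Y]
      proof eventually_elim
        case (elim \<omega>)
        have "X \<omega> * Y \<omega> - Q X \<omega> * Q Y \<omega> = X \<omega> * (Y \<omega> - Q Y \<omega>) + Q Y \<omega> * (X \<omega> - Q X \<omega>)"
          by (simp add: algebra_simps)
        also have "\<bar>\<dots>\<bar> \<le> 1 * e + 1 * e"
          using elim Q01[of Y \<omega>]
          by (intro order_trans[OF abs_triangle_ineq] add_mono)
            (auto simp only: abs_mult intro!: mult_mono)
        finally show ?case by simp
      qed
    qed
    have dX: "\<bar>(\<integral>\<omega>. X \<omega> \<partial>M) - (\<integral>\<omega>. Q X \<omega> \<partial>M)\<bar> \<le> e"
      by (rule integral_diff_le[OF iX iQX approx[OF X]])
    have dY: "\<bar>(\<integral>\<omega>. Y \<omega> \<partial>M) - (\<integral>\<omega>. Q Y \<omega> \<partial>M)\<bar> \<le> e"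
      by (rule integral_diff_le[OF iY iQY approx[OF Y]])
    have X1: "\<bar>\<integral>\<omega>. X \<omega> \<partial>M\<bar> \<le> 1"
    proof -
      have "AE \<omega> in M. \<bar>X \<omega> - 0\<bar> \<le> 1" using X by eventually_elim auto
      then show ?thesis using integral_diff_le[of X "\<lambda>_. 0" 1] iX by simp
    qed
    have QY1: "\<bar>\<integral>\<omega>. Q Y \<omega> \<partial>M\<bar> \<le> 1"
      using integral_diff_le[of "Q Y" "\<lambda>_. 0" 1] iQY Q01[of Y] by auto
    have d2: "\<bar>(\<integral>\<omega>. X \<omega> \<partial>M) * (\<integral>\<omega>. Y \<omega> \<partial>M) - (\<integral>\<omega>. Q X \<omega> \<partial>M) * (\<integral>\<omega>. Q Y \<omega> \<partial>M)\<bar> \<le> 2 * e"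
    proof -
      have "(\<integral>\<omega>. X \<omega> \<partial>M) * (\<integral>\<omega>. Y \<omega> \<partial>M) - (\<integral>\<omega>. Q X \<omega> \<partial>M) * (\<integral>\<omega>. Q Y \<omega> \<partial>M)
        = (\<integral>\<omega>. X \<omega> \<partial>M) * ((\<integral>\<omega>. Y \<omega> \<partial>M) - (\<integral>\<omega>. Q Y \<omega> \<partial>M))
          + (\<integral>\<omega>. Q Y \<omega> \<partial>M) * ((\<integral>\<omega>. X \<omega> \<partial>M) - (\<integral>\<omega>. Q X \<omega> \<partial>M))"
        by (simp only: algebra_simps)
      also have "\<bar>\<dots>\<bar> \<le> 1 * e + 1 * e"
        using X1 QY1 dX dY
        by (intro order_trans[OF abs_triangle_ineq] add_mono) (auto simp only: abs_mult intro!: mult_mono)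
      finally show ?thesis by simp
    qed
    let ?A = "\<lambda>l. {\<omega>\<in>space M. real l / real N \<le> X \<omega>}" and ?B = "\<lambda>l. {\<omega>\<in>space M. real l / real N \<le> Y \<omega>}"
    have m: "?A l \<in> sets M" "?B l \<in> sets M" for l by measurable
    have int_ind: "integrable M (indicator A :: 'a \<Rightarrow> real)" if "A \<in> sets M" for A
      using that by (intro integrable_real_indicator) (auto simp: emeasure_eq_measure)
    have eX: "(\<integral>\<omega>. Q X \<omega> \<partial>M) = (\<Sum>l=1..N. prob (?A l)) / real N"
      unfolding Q_def integral_divide_zero
      by (subst Bochner_Integration.integral_sum) (simp_all add: int_ind m)
    have eY: "(\<integral>\<omega>. Q Y \<omega> \<partial>M) = (\<Sum>l=1..N. prob (?B l)) / real N"
      unfolding Q_def integral_divide_zero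
      by (subst Bochner_Integration.integral_sum) (simp_all add: int_ind m)
    have eXY: "(\<integral>\<omega>. Q X \<omega> * Q Y \<omega> \<partial>M) = (\<Sum>k=1..N. \<Sum>l=1..N. prob (?A k \<inter> ?B l)) / (real N * real N)"
    proof -
      have "Q X \<omega> * Q Y \<omega> = (\<Sum>k=1..N. \<Sum>l=1..N. indicator (?A k \<inter> ?B l) \<omega>) / (real N * real N)" for \<omega>
        unfolding Q_def by (simp add: sum_product indicator_inter_arith)
      then have "(\<integral>\<omega>. Q X \<omega> * Q Y \<omega> \<partial>M)
          = (\<integral>\<omega>. (\<Sum>k=1..N. \<Sum>l=1..N. indicator (?A k \<inter> ?B l) \<omega>) / (real N * real N) \<partial>M)" by simp
      also have "\<dots> = (\<Sum>k=1..N. \<Sum>l=1..N. prob (?A k \<inter> ?B l)) / (real N * real N)"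
        unfolding integral_divide_zero
        by (subst Bochner_Integration.integral_sum,
            force intro!: Bochner_Integration.integrable_sum int_ind sets.Int m)
          (subst Bochner_Integration.integral_sum, simp_all add: int_ind m sets.Int)
      finally show ?thesis .
    qed
    have "(\<integral>\<omega>. Q X \<omega> * Q Y \<omega> \<partial>M) - (\<integral>\<omega>. Q X \<omega> \<partial>M) * (\<integral>\<omega>. Q Y \<omega> \<partial>M)
        = (\<Sum>k=1..N. \<Sum>l=1..N. prob (?A k \<inter> ?B l) - prob (?A k) * prob (?B l)) / (real N * real N)"
      unfolding eX eY eXY by (simp add: sum_product sum_subtractf diff_divide_distrib)
    also have "\<bar>\<dots>\<bar> \<le> (\<Sum>k=1..N. \<Sum>l=1..N. a) / (real N * real N)"
      unfolding abs_divide using mix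
      by (auto intro!: divide_right_mono order_trans[OF sum_abs] sum_mono simp del: sum_constant)
    also have "\<dots> = a" using N by simp
    finally have "\<bar>(\<integral>\<omega>. Q X \<omega> * Q Y \<omega> \<partial>M) - (\<integral>\<omega>. Q X \<omega> \<partial>M) * (\<integral>\<omega>. Q Y \<omega> \<partial>M)\<bar> \<le> a" .
    then show ?thesis using d1 d2 unfolding e_def[symmetric] by linarith
  qed
  have "(\<lambda>N. a + 4 * (1 / real N)) \<longlonglongrightarrow> a + 4 * 0"
    by (intro tendsto_intros lim_1_over_n)
  then show ?thesis
    by (intro LIMSEQ_le_const[of "\<lambda>N. a + 4 * (1 / real N)"] exI[of _ 1]) (use bnd in auto)
qed

text \<open>
  Both functions are mapped affinely to the unit interval, which divides the covariance by
  \<open>(2 * B) * (2 * B')\<close>.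
\<close>
lemma (in prob_space) covariance_le_level_set_mixing:
  fixes X Y :: "'a \<Rightarrow> real"
  assumes [measurable]: "X \<in> borel_measurable M" "Y \<in> borel_measurable M"
    and X: "AE \<omega> in M. \<bar>X \<omega>\<bar> \<le> B" and Y: "AE \<omega> in M. \<bar>Y \<omega>\<bar> \<le> B'"
    and B: "B > 0" "B' > 0"
    and mix: "\<And>s t. \<bar>prob ({\<omega>\<in>space M. s \<le> X \<omega>} \<inter> {\<omega>\<in>space M. t \<le> Y \<omega>})
        - prob {\<omega>\<in>space M. s \<le> X \<omega>} * prob {\<omega>\<in>space M. t \<le> Y \<omega>}\<bar> \<le> a"
  shows "\<bar>(\<integral>\<omega>. X \<omega> * Y \<omega> \<partial>M) - (\<integral>\<omega>. X \<omega> \<partial>M) * (\<integral>\<omega>. Y \<omega> \<partial>M)\<bar> \<le> 4 * B * B' * a"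
proof -
  let ?u = "\<lambda>b z. (z / b + 1) / (2::real)"
  have iX: "integrable M X" by (rule integrable_const_bound[where B=B]) (use X in auto)
  have iY: "integrable M Y" by (rule integrable_const_bound[where B=B']) (use Y in auto)
  have iXY: "integrable M (\<lambda>\<omega>. X \<omega> * Y \<omega>)"
  proof (rule integrable_const_bound[where B="B * B'"])
    show "AE \<omega> in M. norm (X \<omega> * Y \<omega>) \<le> B * B'"
      using X Y by eventually_elim (use B in \<open>simp add: abs_mult mult_mono\<close>)
  qed simp
  have unit: "AE \<omega> in M. 0 \<le> ?u b (Z \<omega>) \<and> ?u b (Z \<omega>) \<le> 1"
    if "AE \<omega> in M. \<bar>Z \<omega>\<bar> \<le> b" "b > 0" for Z b
    using that(1) by eventually_elim (use that(2) in \<open>auto simp: field_simps abs_le_iff\<close>)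
  have level: "s \<le> ?u b z \<longleftrightarrow> b * (2 * s - 1) \<le> z" if "b > 0" for s b z
    using that by (simp add: field_simps)
  have "\<bar>(\<integral>\<omega>. ?u B (X \<omega>) * ?u B' (Y \<omega>) \<partial>M) - (\<integral>\<omega>. ?u B (X \<omega>) \<partial>M) * (\<integral>\<omega>. ?u B' (Y \<omega>) \<partial>M)\<bar> \<le> a"
    by (rule covariance_le_level_set_mixing_unit[OF _ _ unit[OF X B(1)] unit[OF Y B(2)]])
       (unfold level[OF B(1)] level[OF B(2)], measurable, rule mix)
  moreover have "(\<integral>\<omega>. ?u B (X \<omega>) * ?u B' (Y \<omega>) \<partial>M)
     = ((\<integral>\<omega>. X \<omega> * Y \<omega> \<partial>M) / (B * B') + (\<integral>\<omega>. X \<omega> \<partial>M) / B + (\<integral>\<omega>. Y \<omega> \<partial>M) / B' + 1) / 4"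
  proof -
    have "?u B (X \<omega>) * ?u B' (Y \<omega>) = (X \<omega> * Y \<omega> / (B * B') + X \<omega> / B + Y \<omega> / B' + 1) / 4" for \<omega>
      using B by (simp add: field_simps)
    then show ?thesis using iX iY iXY by (simp add: prob_space)
  qed
  moreover have "(\<integral>\<omega>. ?u B (X \<omega>) \<partial>M) = ((\<integral>\<omega>. X \<omega> \<partial>M) / B + 1) / 2"
    "(\<integral>\<omega>. ?u B' (Y \<omega>) \<partial>M) = ((\<integral>\<omega>. Y \<omega> \<partial>M) / B' + 1) / 2"
    using iX iY by (simp_all add: prob_space)
  ultimately have "\<bar>((\<integral>\<omega>. X \<omega> * Y \<omega> \<partial>M) - (\<integral>\<omega>. X \<omega> \<partial>M) * (\<integral>\<omega>. Y \<omega> \<partial>M)) / (4 * B * B')\<bar> \<le> a"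
    using B by (simp add: field_simps)
  then show ?thesis using B by (simp add: abs_divide abs_mult field_simps)
qed

section \<open>Functions of finitely or cofinitely many coordinates\<close>

lemma sets_coord_sigma:
  "sets (sigma (space (seq_space M0))
     {(\<lambda>\<omega>. \<omega> m) -` A \<inter> space (seq_space M0) | m A. m \<in> I \<and> A \<in> sets M0}) = coord_sigma M0 I"
  unfolding coord_sigma_def by (intro sets_measure_of) auto

text \<open>
  The map with coordinates \<open>h n\<close> only reads coordinates in \<open>I\<close>, so it is measurable from the
  sigma-algebra generated by them to the full product, where \<open>X\<close> is measurable.
\<close>
lemma level_set_in_coord_sigma:
  fixes X :: "(nat \<Rightarrow> 'o) \<Rightarrow> real"
  assumes X: "X \<in> borel_measurable (seq_space M0)" and I: "I \<subseteq> {1..}"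
    and h: "\<And>n. n \<ge> 1 \<Longrightarrow> (\<exists>m\<in>I. h n = (\<lambda>\<omega>. \<omega> m)) \<or> (\<exists>c\<in>space M0. h n = (\<lambda>\<omega>. c))"
  shows "{\<omega>\<in>space (seq_space M0). t \<le> X (\<lambda>n\<in>{1..}. h n \<omega>)} \<in> coord_sigma M0 I"
proof -
  define N where "N = sigma (space (seq_space M0))
     {(\<lambda>\<omega>. \<omega> m) -` A \<inter> space (seq_space M0) | m A. m \<in> I \<and> A \<in> sets M0}"
  have sp: "space N = space (seq_space M0)"
    unfolding N_def by (intro space_measure_of) auto
  have coord: "(\<lambda>\<omega>. \<omega> m) \<in> measurable N M0" if m: "m \<in> I" for m
  proof (rule measurableI)
    show "\<omega> m \<in> space M0" if "\<omega> \<in> space N" for \<omega>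
      using that m I unfolding sp space_PiM by auto
    show "(\<lambda>\<omega>. \<omega> m) -` A \<inter> space N \<in> sets N" if "A \<in> sets M0" for A
      unfolding sp unfolding N_def sets_coord_sigma unfolding coord_sigma_def
      using that m by (intro sigma_sets.Basic) auto
  qed
  have "(\<lambda>\<omega>. \<lambda>n\<in>{1..}. h n \<omega>) \<in> measurable N (seq_space M0)"
  proof (rule measurable_restrict)
    show "h n \<in> measurable N M0" if "n \<in> {1..}" for n
      using h[of n] that coord by auto
  qed
  then have "(\<lambda>\<omega>. X (\<lambda>n\<in>{1..}. h n \<omega>)) \<in> borel_measurable N"
    using X by (rule measurable_compose)
  then have "{\<omega>\<in>space N. t \<le> X (\<lambda>n\<in>{1..}. h n \<omega>)} \<in> sets N" by measurable
  then show ?thesis unfolding sp unfolding N_def sets_coord_sigma .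
qed

text \<open>
  Freezing the coordinates after \<open>j\<close> at those of a fixed sequence does not change \<open>X\<close>, but makes it
  visibly a function of the first \<open>j\<close> coordinates.
\<close>
lemma past_level_set:
  fixes X :: "(nat \<Rightarrow> 'o) \<Rightarrow> real"
  assumes X: "X \<in> borel_measurable (seq_space M0)"
    and dep: "\<And>\<omega> \<omega>'. (\<And>n. 1 \<le> n \<Longrightarrow> n \<le> j \<Longrightarrow> \<omega> n = \<omega>' n) \<Longrightarrow> X \<omega> = X \<omega>'"
  shows "{\<omega>\<in>space (seq_space M0). t \<le> X \<omega>} \<in> coord_sigma M0 {1..j}"
proof (cases "space (seq_space M0) = {}")
  case True
  then have "{\<omega>\<in>space (seq_space M0). t \<le> X \<omega>} = {}" by blast
  then show ?thesis unfolding coord_sigma_def by (simp only: sigma_sets.Empty)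
next
  case False
  then obtain w0 where w0: "w0 \<in> space (seq_space M0)" by blast
  define h where "h n = (if n \<le> j then (\<lambda>\<omega>. \<omega> n) else (\<lambda>\<omega>. w0 n))" for n :: nat
  have "{\<omega>\<in>space (seq_space M0). t \<le> X (\<lambda>n\<in>{1..}. h n \<omega>)} \<in> coord_sigma M0 {1..j}"
    using w0 by (intro level_set_in_coord_sigma[OF X]) (auto simp: h_def space_PiM)
  moreover have "X (\<lambda>n\<in>{1..}. h n \<omega>) = X \<omega>" for \<omega> by (rule dep) (auto simp: h_def)
  ultimately show ?thesis by simp
qed

lemma shift_funpow_apply: "1 \<le> n \<Longrightarrow> (shift ^^ r) \<omega> n = \<omega> (n + r)"
  by (induction r arbitrary: n) (auto simp: shift_def)

lemma shift_funpow_eq: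
  assumes "\<omega> \<in> space (seq_space M0)"
  shows "(shift ^^ r) \<omega> = (\<lambda>n\<in>{1..}. \<omega> (n + r))"
proof
  fix n
  show "(shift ^^ r) \<omega> n = (\<lambda>n\<in>{1..}. \<omega> (n + r)) n"
  proof (cases "1 \<le> n")
    case True
    then show ?thesis by (simp add: shift_funpow_apply)
  next
    case False
    then show ?thesis using assms by (cases r) (auto simp: shift_def space_PiM PiE_def extensional_def)
  qed
qed

lemma measurable_shift_funpow [measurable]:
  "(shift ^^ r) \<in> measurable (seq_space M0) (seq_space M0)"
proof -
  have "(\<lambda>\<omega>. \<lambda>n\<in>{1..}. \<omega> (n + r)) \<in> measurable (seq_space M0) (seq_space M0)"
    by (intro measurable_restrict measurable_component_singleton) auto
  then show ?thesis by (subst measurable_cong[OF shift_funpow_eq]) auto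
qed

lemma future_level_set:
  fixes X :: "(nat \<Rightarrow> 'o) \<Rightarrow> real"
  assumes X: "X \<in> borel_measurable (seq_space M0)"
  shows "{\<omega>\<in>space (seq_space M0). t \<le> X ((shift ^^ r) \<omega>)} \<in> coord_sigma M0 {Suc r..}"
proof -
  have "{\<omega>\<in>space (seq_space M0). t \<le> X (\<lambda>n\<in>{1..}. \<omega> (n + r))} \<in> coord_sigma M0 {Suc r..}"
    by (intro level_set_in_coord_sigma[OF X]) (auto intro!: bexI)
  moreover have "{\<omega>\<in>space (seq_space M0). t \<le> X (\<lambda>n\<in>{1..}. \<omega> (n + r))}
      = {\<omega>\<in>space (seq_space M0). t \<le> X ((shift ^^ r) \<omega>)}"
    by (auto simp: shift_funpow_eq)
  ultimately show ?thesis by simp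
qed

section \<open>Sums of powers\<close>

text \<open>
  The comparison of a power sum with an integral, in the form of the mean value theorem. Negative \<open>q\<close>
  serves the tails of convergent sums, positive \<open>q\<close> the growth of divergent ones.
\<close>
lemma powr_increment_ge:
  fixes x q :: real
  assumes x: "x > 0" and q: "q < 1" "q \<noteq> 0"
  shows "(x + 1) powr (q - 1) \<le> ((x + 1) powr q - x powr q) / q"
proof -
  have "\<exists>z>x. z < x + 1 \<and> (x + 1) powr q - x powr q = (x + 1 - x) * (q * z powr (q - 1))"
    using x by (intro MVT2) (auto intro!: derivative_eq_intros simp: powr_diff)
  then obtain z where z: "x < z" "z < x + 1" "(x + 1) powr q - x powr q = q * z powr (q - 1)" by auto
  have "(x + 1) powr (q - 1) \<le> z powr (q - 1)"
    using z x q by (intro powr_mono2') auto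
  then show ?thesis using z q by simp
qed

lemma sum_powr_le:
  fixes s :: real
  assumes s: "0 < s" "s < 1"
  shows "(\<Sum>d=1..n. real d powr (- s)) \<le> real n powr (1 - s) / (1 - s)"
proof (induction n)
  case (Suc n)
  show ?case
  proof (cases "n = 0")
    case True
    then show ?thesis using s by simp
  next
    case False
    have "real (Suc n) powr (- s) \<le> (real (Suc n) powr (1 - s) - real n powr (1 - s)) / (1 - s)"
      using powr_increment_ge[of "real n" "1 - s"] False s by (simp add: add.commute)
    then show ?thesis using Suc.IH by (simp add: diff_divide_distrib)
  qed
qed simp

lemma sum_powr_tail_le:
  fixes \<psi> :: real
  assumes \<psi>: "\<psi> > 1" and K: "K \<ge> 1"
  shows "(\<Sum>k\<in>{K..<n}. real k powr (- \<psi>)) \<le> (1 + 1 / (\<psi> - 1)) * real K powr (1 - \<psi>)"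
proof -
  have main: "(\<Sum>k\<in>{K..<Suc m}. real k powr (- \<psi>))
      \<le> real K powr (- \<psi>) + (real K powr (1 - \<psi>) - real m powr (1 - \<psi>)) / (\<psi> - 1)" if "m \<ge> K" for m
    using that
  proof (induction m rule: dec_induct)
    case base
    then show ?case by simp
  next
    case (step m)
    have "real (Suc m) powr (- \<psi>) \<le> (real (Suc m) powr (1 - \<psi>) - real m powr (1 - \<psi>)) / (1 - \<psi>)"
      using powr_increment_ge[of "real m" "1 - \<psi>"] step K \<psi> by (simp add: add.commute)
    also have "\<dots> = (real m powr (1 - \<psi>) - real (Suc m) powr (1 - \<psi>)) / (\<psi> - 1)"
      using \<psi> by (simp add: field_simps)
    finally show ?case using step by (simp add: diff_divide_distrib)
  qed
  have le: "real K powr (- \<psi>) \<le> real K powr (1 - \<psi>)" using K by (intro powr_mono) auto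
  show ?thesis
  proof (cases "n > K")
    case True
    then obtain m where m: "n = Suc m" "m \<ge> K" by (cases n) auto
    have "(real K powr (1 - \<psi>) - real m powr (1 - \<psi>)) / (\<psi> - 1) \<le> real K powr (1 - \<psi>) / (\<psi> - 1)"
      using \<psi> by (intro divide_right_mono) auto
    then show ?thesis using main[OF m(2)] le m by (simp add: algebra_simps)
  next
    case False
    then show ?thesis using \<psi> by simp
  qed
qed

lemma poly_rate_tail_le:
  assumes \<psi>: "\<psi> > 1" and K: "K \<ge> 1" and A: "A \<ge> 0" and summ: "summable (poly_rate A \<psi>)"
  shows "(\<Sum>k. poly_rate A \<psi> (k + K)) \<le> A * (1 + 1 / (\<psi> - 1)) * real K powr (1 - \<psi>)"
proof (rule suminf_le_const)
  show "summable (\<lambda>k. poly_rate A \<psi> (k + K))" using summ by (rule summable_ignore_initial_segment)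
  fix n
  have "(\<Sum>k<n. poly_rate A \<psi> (k + K)) = (\<Sum>k\<in>{K..<n + K}. poly_rate A \<psi> k)"
    using sum.shift_bounds_nat_ivl[of "poly_rate A \<psi>" 0 K n] by (simp add: atLeast0LessThan)
  also have "\<dots> = A * (\<Sum>k\<in>{K..<n + K}. real k powr (- \<psi>))"
    unfolding sum_distrib_left using K by (intro sum.cong) (auto simp: poly_rate_def)
  also have "\<dots> \<le> A * ((1 + 1 / (\<psi> - 1)) * real K powr (1 - \<psi>))"
    using sum_powr_tail_le[OF \<psi> K] A by (intro mult_left_mono) auto
  finally show "(\<Sum>k<n. poly_rate A \<psi> (k + K)) \<le> A * (1 + 1 / (\<psi> - 1)) * real K powr (1 - \<psi>)" by simp
qed

section \<open>Averages of an approximately stationary array\<close>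

text \<open>
  The weight \<open>2 - \<delta>\<^sub>k\<^sub>0\<close> of the \<open>k\<close>-th diagonal when a symmetric matrix is summed over one triangle.
\<close>
definition diag_weight :: "nat \<Rightarrow> real" where
  "diag_weight k = 2 - (if k = 0 then 1 else 0)"

lemma diag_weight_bounds: "0 \<le> diag_weight k" "\<bar>diag_weight k\<bar> \<le> 2"
  by (auto simp: diag_weight_def)

lemma sum_rows_eq_sum_diagonals:
  fixes a :: "nat \<Rightarrow> nat \<Rightarrow> real"
  shows "(\<Sum>j<n. \<Sum>i\<in>{0..j}. diag_weight (j - i) * a i (j - i))
    = (\<Sum>k<n. diag_weight k * (\<Sum>i<n - k. a i k))"
proof -
  have "(\<Sum>j<n. \<Sum>i\<in>{0..j}. diag_weight (j - i) * a i (j - i))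
      = (\<Sum>(j,i)\<in>Sigma {..<n} (\<lambda>j. {0..j}). diag_weight (j - i) * a i (j - i))"
    by (subst sum.Sigma) auto
  also have "\<dots> = (\<Sum>(k,i)\<in>Sigma {..<n} (\<lambda>k. {..<n - k}). diag_weight k * a i k)"
    by (rule sum.reindex_bij_witness[of _ "\<lambda>(k,i). (k + i, i)" "\<lambda>(j,i). (j - i, i)"]) auto
  also have "\<dots> = (\<Sum>k<n. diag_weight k * (\<Sum>i<n - k. a i k))"
    by (subst sum.Sigma[symmetric]) (auto simp: sum_distrib_left)
  finally show ?thesis .
qed

text \<open>
  The part of the argument that concerns expectations only. In the application \<open>a i k\<close> is the
  expectation of \<open>c i k\<close>, the covariance of \<open>f\<^sub>i\<close> and \<open>f\<^sub>i\<^sub>+\<^sub>k\<close>, then \<open>b r k i\<close> is the expectation of \<open>c r k\<close>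
  after \<open>i\<close> shifts, and \<open>L r k\<close> is its mean under the stationary measure.
\<close>
locale approx_stationary =
  fixes a :: "nat \<Rightarrow> nat \<Rightarrow> real" and b :: "nat \<Rightarrow> nat \<Rightarrow> nat \<Rightarrow> real"
    and L :: "nat \<Rightarrow> nat \<Rightarrow> real" and \<eta> :: "nat \<Rightarrow> real" and C1 C2 \<zeta> :: real
  assumes eta_nonneg: "\<And>k. 0 \<le> \<eta> k" and eta_summable: "summable \<eta>"
    and a_bound: "\<And>i k. \<bar>a i k\<bar> \<le> \<eta> k"
    and a_b: "\<And>r i k. \<bar>a (r + i) k - b r k i\<bar> \<le> C1 * \<eta> r"
    and b_avg: "\<And>n r k. n \<ge> 1 \<Longrightarrow> \<bar>(\<Sum>i<n. b r k i) / real n - L r k\<bar> \<le> C2 * real n powr (- \<zeta>)"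
    and C1: "C1 \<ge> 0" and C2: "C2 \<ge> 0" and zeta: "0 < \<zeta>" "\<zeta> \<le> 1"
begin

lemma rate_tendsto_0: "(\<lambda>n. real n powr (- \<zeta>)) \<longlonglongrightarrow> 0"
  using zeta by (intro tendsto_neg_powr filterlim_real_sequentially) auto

lemma abs_L_le: "\<bar>L r k\<bar> \<le> \<eta> k + C1 * \<eta> r"
proof -
  have "\<bar>L r k\<bar> \<le> \<eta> k + C1 * \<eta> r + C2 * real n powr (- \<zeta>)" if n: "n \<ge> 1" for n
  proof -
    have "\<bar>b r k i\<bar> \<le> \<eta> k + C1 * \<eta> r" for i
      using a_bound[of "r + i" k] a_b[of r i k] by linarith
    then have "\<bar>\<Sum>i<n. b r k i\<bar> \<le> (\<Sum>i<n. \<eta> k + C1 * \<eta> r)"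
      by (intro order_trans[OF sum_abs] sum_mono)
    then have "\<bar>(\<Sum>i<n. b r k i) / real n\<bar> \<le> \<eta> k + C1 * \<eta> r"
      using n by (simp add: divide_le_eq mult.commute)
    then show ?thesis using b_avg[OF n, of r k] by linarith
  qed
  moreover have "(\<lambda>n. \<eta> k + C1 * \<eta> r + C2 * real n powr (- \<zeta>)) \<longlonglongrightarrow> \<eta> k + C1 * \<eta> r + C2 * 0"
    by (intro tendsto_intros rate_tendsto_0)
  ultimately show ?thesis
    by (intro LIMSEQ_le_const[where X = "\<lambda>n. \<eta> k + C1 * \<eta> r + C2 * real n powr (- \<zeta>)"]) auto
qed

text \<open>
  Beyond the first \<open>r\<close> summands, \<open>a (r + i) k\<close> may be replaced by \<open>b r k i\<close>, whose average is known;
  the first \<open>r\<close> summands are bounded trivially.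
\<close>
lemma average_approx:
  assumes r: "r < n"
  shows "\<bar>(\<Sum>i<n. a i k) / real n - L r k\<bar>
    \<le> 2 * \<eta> k * (real r / real n) + 2 * C1 * \<eta> r + C2 * real n powr (- \<zeta>)"
proof -
  define m where "m = n - r"
  have m: "m \<ge> 1" "real m \<le> real n" "n = r + m" using r by (auto simp: m_def)
  have split: "(\<Sum>i<n. a i k) = (\<Sum>i<r. a i k) + (\<Sum>i<m. a (r + i) k)"
    unfolding m(3) by (induction m) auto
  have e1: "\<bar>\<Sum>i<r. a i k\<bar> \<le> real r * \<eta> k"
    using order_trans[OF sum_abs sum_mono[of "{..<r}" "\<lambda>i. \<bar>a i k\<bar>" "\<lambda>_. \<eta> k"]] a_bound by simp
  have e2: "\<bar>(\<Sum>i<m. a (r + i) k) - (\<Sum>i<m. b r k i)\<bar> \<le> real n * (C1 * \<eta> r)"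
  proof -
    have "\<bar>(\<Sum>i<m. a (r + i) k) - (\<Sum>i<m. b r k i)\<bar> \<le> (\<Sum>i<m. C1 * \<eta> r)"
      unfolding sum_subtractf[symmetric] using a_b by (intro order_trans[OF sum_abs] sum_mono)
    also have "\<dots> \<le> real n * (C1 * \<eta> r)"
      using m(2) C1 eta_nonneg[of r] by (simp add: mult_right_mono)
    finally show ?thesis .
  qed
  have e3: "\<bar>(\<Sum>i<m. b r k i) - real m * L r k\<bar> \<le> real n * (C2 * real n powr (- \<zeta>))"
  proof -
    have "\<bar>(\<Sum>i<m. b r k i) - real m * L r k\<bar> = real m * \<bar>(\<Sum>i<m. b r k i) / real m - L r k\<bar>"
    proof -
      have "(\<Sum>i<m. b r k i) - real m * L r k = real m * ((\<Sum>i<m. b r k i) / real m - L r k)"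
        using m(1) by (simp add: right_diff_distrib)
      then show ?thesis by (simp only: abs_mult abs_of_nat)
    qed
    also have "\<dots> \<le> real m * (C2 * real m powr (- \<zeta>))"
      using b_avg[OF m(1), of r k] by (intro mult_left_mono) auto
    also have "\<dots> = C2 * real m powr (1 - \<zeta>)"
      using m(1) by (simp add: powr_diff powr_minus divide_simps)
    also have "\<dots> \<le> C2 * real n powr (1 - \<zeta>)"
      using m(1,2) zeta C2 by (intro mult_left_mono powr_mono2) auto
    also have "\<dots> = real n * (C2 * real n powr (- \<zeta>))"
      using r by (simp add: powr_diff powr_minus divide_simps)
    finally show ?thesis .
  qed
  have e4: "real r * \<bar>L r k\<bar> \<le> real r * \<eta> k + real n * (C1 * \<eta> r)"
  proof -
    have "real r * \<bar>L r k\<bar> \<le> real r * \<eta> k + real r * (C1 * \<eta> r)"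
      using abs_L_le[of r k] by (simp add: distrib_left[symmetric] mult_left_mono)
    moreover have "real r * (C1 * \<eta> r) \<le> real n * (C1 * \<eta> r)"
      using r C1 eta_nonneg[of r] by (intro mult_right_mono) auto
    ultimately show ?thesis by linarith
  qed
  have "(\<Sum>i<n. a i k) - real n * L r k = (\<Sum>i<r. a i k) - real r * L r k
      + ((\<Sum>i<m. a (r + i) k) - (\<Sum>i<m. b r k i)) + ((\<Sum>i<m. b r k i) - real m * L r k)"
    unfolding split using m(3) by (simp add: algebra_simps)
  then have "\<bar>(\<Sum>i<n. a i k) - real n * L r k\<bar> \<le> real r * \<eta> k + real r * \<bar>L r k\<bar>
      + real n * (C1 * \<eta> r) + real n * (C2 * real n powr (- \<zeta>))"
    using e1 e2 e3 abs_mult[of "real r" "L r k"] by simp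
  also have "\<dots> \<le> 2 * (real r * \<eta> k) + 2 * (real n * (C1 * \<eta> r)) + real n * (C2 * real n powr (- \<zeta>))"
    using e4 by linarith
  finally have "\<bar>(\<Sum>i<n. a i k) - real n * L r k\<bar> / real n
      \<le> (2 * (real r * \<eta> k) + 2 * (real n * (C1 * \<eta> r)) + real n * (C2 * real n powr (- \<zeta>))) / real n"
    by (intro divide_right_mono) auto
  also have "\<dots> = 2 * \<eta> k * (real r / real n) + 2 * C1 * \<eta> r + C2 * real n powr (- \<zeta>)"
    using r by (simp add: add_divide_distrib)
  also have "\<bar>(\<Sum>i<n. a i k) - real n * L r k\<bar> / real n = \<bar>(\<Sum>i<n. a i k) / real n - L r k\<bar>"
  proof -
    have "((\<Sum>i<n. a i k) - real n * L r k) / real n = (\<Sum>i<n. a i k) / real n - L r k"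
      using r by (simp add: diff_divide_distrib)
    moreover have "\<bar>(\<Sum>i<n. a i k) - real n * L r k\<bar> / real n
        = \<bar>((\<Sum>i<n. a i k) - real n * L r k) / real n\<bar>" by simp
    ultimately show ?thesis by (simp only:)
  qed
  finally show ?thesis .
qed

text \<open>
  \<open>L r k\<close> and \<open>L s k\<close> are compared with the same average of \<open>a\<close>, whose length tends to infinity.
\<close>
lemma L_Cauchy_bound: "\<bar>L r k - L s k\<bar> \<le> 2 * C1 * \<eta> r + 2 * C1 * \<eta> s"
proof -
  let ?R = "\<lambda>n. (2 * \<eta> k * (real r / real n) + 2 * C1 * \<eta> r + C2 * real n powr (- \<zeta>))
    + (2 * \<eta> k * (real s / real n) + 2 * C1 * \<eta> s + C2 * real n powr (- \<zeta>))"
  have "\<bar>L r k - L s k\<bar> \<le> ?R n" if "n \<ge> Suc (max r s)" for n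
    using average_approx[of r n k] average_approx[of s n k] that by linarith
  moreover have "?R \<longlonglongrightarrow> (2 * \<eta> k * 0 + 2 * C1 * \<eta> r + C2 * 0) + (2 * \<eta> k * 0 + 2 * C1 * \<eta> s + C2 * 0)"
    by (intro tendsto_intros rate_tendsto_0 lim_const_over_n)
  ultimately have "\<bar>L r k - L s k\<bar> \<le> (2 * \<eta> k * 0 + 2 * C1 * \<eta> r + C2 * 0) + (2 * \<eta> k * 0 + 2 * C1 * \<eta> s + C2 * 0)"
    by (intro LIMSEQ_le_const[where X = ?R]) auto
  then show ?thesis by simp
qed

lemma eta_tendsto_0: "\<eta> \<longlonglongrightarrow> 0"
  using eta_summable by (rule summable_LIMSEQ_zero)

lemma convergent_L: "convergent (\<lambda>r. L r k)"
proof -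
  have "Cauchy (\<lambda>r. L r k)"
  proof (rule metric_CauchyI)
    fix e :: real assume e: "e > 0"
    have "(\<lambda>r. 2 * C1 * \<eta> r) \<longlonglongrightarrow> 2 * C1 * 0" by (intro tendsto_intros eta_tendsto_0)
    then have "\<forall>\<^sub>F r in sequentially. 2 * C1 * \<eta> r < e / 2"
      using e by (intro order_tendstoD) auto
    then obtain N where N: "\<And>r. r \<ge> N \<Longrightarrow> 2 * C1 * \<eta> r < e / 2"
      by (auto simp: eventually_sequentially)
    have "dist (L r k) (L s k) < e" if "r \<ge> N" "s \<ge> N" for r s
      using L_Cauchy_bound[of r k s] N[OF that(1)] N[OF that(2)] by (simp add: dist_real_def)
    then show "\<exists>N. \<forall>m\<ge>N. \<forall>n\<ge>N. dist (L m k) (L n k) < e" by blast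
  qed
  then show ?thesis by (simp add: Cauchy_convergent_iff)
qed

definition Linf :: "nat \<Rightarrow> real" where "Linf k = lim (\<lambda>r. L r k)"

lemma L_tendsto: "(\<lambda>r. L r k) \<longlonglongrightarrow> Linf k"
  unfolding Linf_def using convergent_L by (simp add: convergent_LIMSEQ_iff)

lemma L_Linf: "\<bar>L r k - Linf k\<bar> \<le> 2 * C1 * \<eta> r"
proof -
  have "(\<lambda>s. \<bar>L r k - L s k\<bar>) \<longlonglongrightarrow> \<bar>L r k - Linf k\<bar>"
    by (intro tendsto_intros L_tendsto)
  moreover have "(\<lambda>s. 2 * C1 * \<eta> r + 2 * C1 * \<eta> s) \<longlonglongrightarrow> 2 * C1 * \<eta> r + 2 * C1 * 0"
    by (intro tendsto_intros eta_tendsto_0)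
  ultimately have "\<bar>L r k - Linf k\<bar> \<le> 2 * C1 * \<eta> r + 2 * C1 * 0"
    by (rule LIMSEQ_le) (use L_Cauchy_bound in auto)
  then show ?thesis by simp
qed

lemma abs_Linf_le: "\<bar>Linf k\<bar> \<le> \<eta> k"
proof -
  have "(\<lambda>r. \<bar>L r k\<bar>) \<longlonglongrightarrow> \<bar>Linf k\<bar>" by (intro tendsto_intros L_tendsto)
  moreover have "(\<lambda>r. \<eta> k + C1 * \<eta> r) \<longlonglongrightarrow> \<eta> k + C1 * 0"
    by (intro tendsto_intros eta_tendsto_0)
  ultimately have "\<bar>Linf k\<bar> \<le> \<eta> k + C1 * 0"
    by (rule LIMSEQ_le) (use abs_L_le in auto)
  then show ?thesis by simp
qed

lemma summable_weighted_Linf: "summable (\<lambda>k. \<bar>diag_weight k * Linf k\<bar>)"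
proof (rule summable_comparison_test'[where N=0])
  show "summable (\<lambda>k. 2 * \<eta> k)" using eta_summable by (rule summable_mult)
  show "norm \<bar>diag_weight k * Linf k\<bar> \<le> 2 * \<eta> k" for k
    using mult_mono[OF diag_weight_bounds(2) abs_Linf_le, of k k] by (simp add: abs_mult)
qed

text \<open>
  The diagonals \<open>k < K\<close> are evaluated by \<open>average_approx\<close> with \<open>r = K\<close>, at a price that does not
  depend on \<open>k\<close> except through the summable \<open>\<eta> k\<close>. The others are bounded by the tail of \<open>\<eta>\<close>, twice for the
  averages and twice for the limits because of the weight \<open>2\<close>.
\<close>
lemma weighted_average_approx:
  assumes K: "1 \<le> K" "K < n"
  shows "\<bar>(\<Sum>k<n. diag_weight k * (\<Sum>i<n - k. a i k)) / real n - (\<Sum>k. diag_weight k * Linf k)\<bar>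
    \<le> 6 * suminf \<eta> * (real K / real n) + 8 * C1 * (real K * \<eta> K) + 2 * C2 * (real K * real n powr (- \<zeta>))
      + 4 * (\<Sum>k. \<eta> (k + K))"
proof -
  define v where "v k = diag_weight k * (\<Sum>i<n - k. a i k) / real n" for k
  define w where "w k = diag_weight k * Linf k" for k
  define t where "t = (\<Sum>k. \<eta> (k + K))"
  have n: "real n > 0" using K by simp
  have summ_w: "summable w" unfolding w_def using summable_weighted_Linf by (rule summable_rabs_cancel)
  have summ_eta: "summable (\<lambda>k. \<eta> (k + K))" using eta_summable by (rule summable_ignore_initial_segment)
  have head: "\<bar>v k - w k\<bar> \<le> 6 * \<eta> k * (real K / real n) + (8 * C1 * \<eta> K + 2 * C2 * real n powr (- \<zeta>))"
    if k: "k < K" for k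
  proof -
    have "(\<Sum>i<n. a i k) = (\<Sum>i<n - k. a i k) + (\<Sum>i\<in>{n - k..<n}. a i k)"
      by (simp add: lessThan_atLeast0 sum.atLeastLessThan_concat)
    moreover have "\<bar>\<Sum>i\<in>{n - k..<n}. a i k\<bar> \<le> real K * \<eta> k"
    proof -
      have "\<bar>\<Sum>i\<in>{n - k..<n}. a i k\<bar> \<le> (\<Sum>i\<in>{n - k..<n}. \<eta> k)"
        using a_bound by (intro order_trans[OF sum_abs] sum_mono)
      also have "\<dots> \<le> real K * \<eta> k" using k eta_nonneg[of k] by (simp add: mult_right_mono)
      finally show ?thesis .
    qed
    ultimately have "\<bar>(\<Sum>i<n - k. a i k) - (\<Sum>i<n. a i k)\<bar> \<le> real K * \<eta> k" by simp
    then have "\<bar>(\<Sum>i<n - k. a i k) - (\<Sum>i<n. a i k)\<bar> / real n \<le> real K * \<eta> k / real n"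
      by (intro divide_right_mono) auto
    then have "\<bar>(\<Sum>i<n - k. a i k) / real n - (\<Sum>i<n. a i k) / real n\<bar> \<le> \<eta> k * (real K / real n)"
      by (simp add: diff_divide_distrib[symmetric] mult.commute)
    then have "\<bar>(\<Sum>i<n - k. a i k) / real n - Linf k\<bar>
        \<le> 3 * \<eta> k * (real K / real n) + (4 * C1 * \<eta> K + C2 * real n powr (- \<zeta>))"
      using average_approx[OF K(2), of k] L_Linf[of K k] by linarith
    then have "\<bar>diag_weight k\<bar> * \<bar>(\<Sum>i<n - k. a i k) / real n - Linf k\<bar>
        \<le> 2 * (3 * \<eta> k * (real K / real n) + (4 * C1 * \<eta> K + C2 * real n powr (- \<zeta>)))"
      by (intro mult_mono diag_weight_bounds) auto
    then show ?thesis by (simp add: v_def w_def abs_mult[symmetric] right_diff_distrib)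
  qed
  have "\<bar>(\<Sum>k<K. v k) - (\<Sum>k<K. w k)\<bar>
      \<le> (\<Sum>k<K. 6 * \<eta> k * (real K / real n) + (8 * C1 * \<eta> K + 2 * C2 * real n powr (- \<zeta>)))"
    unfolding sum_subtractf[symmetric] using head by (intro order_trans[OF sum_abs] sum_mono) auto
  also have "\<dots> = 6 * (\<Sum>k<K. \<eta> k) * (real K / real n) + real K * (8 * C1 * \<eta> K + 2 * C2 * real n powr (- \<zeta>))"
    by (simp add: sum.distrib sum_distrib_left sum_distrib_right sum_divide_distrib)
  also have "\<dots> \<le> 6 * suminf \<eta> * (real K / real n) + real K * (8 * C1 * \<eta> K + 2 * C2 * real n powr (- \<zeta>))"
    using eta_summable eta_nonneg by (intro add_right_mono mult_right_mono mult_left_mono sum_le_suminf) auto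
  finally have h: "\<bar>(\<Sum>k<K. v k) - (\<Sum>k<K. w k)\<bar> \<le> \<dots>" .
  have t1: "\<bar>\<Sum>k\<in>{K..<n}. v k\<bar> \<le> 2 * t"
  proof -
    have "\<bar>v k\<bar> \<le> 2 * \<eta> k" for k
    proof -
      have "\<bar>\<Sum>i<n - k. a i k\<bar> \<le> (\<Sum>i<n - k. \<eta> k)"
        using a_bound by (intro order_trans[OF sum_abs] sum_mono)
      also have "\<dots> \<le> real n * \<eta> k" using eta_nonneg[of k] by (simp add: mult_right_mono)
      finally have "\<bar>\<Sum>i<n - k. a i k\<bar> / real n \<le> \<eta> k" using n by (simp add: divide_le_eq mult.commute)
      then have "\<bar>diag_weight k\<bar> * (\<bar>\<Sum>i<n - k. a i k\<bar> / real n) \<le> 2 * \<eta> k"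
        by (intro mult_mono diag_weight_bounds) auto
      then show ?thesis by (simp add: v_def abs_mult)
    qed
    then have "\<bar>\<Sum>k\<in>{K..<n}. v k\<bar> \<le> (\<Sum>k\<in>{K..<n}. 2 * \<eta> k)"
      by (intro order_trans[OF sum_abs] sum_mono)
    also have "\<dots> = 2 * (\<Sum>k<n - K. \<eta> (k + K))"
      using sum.shift_bounds_nat_ivl[of \<eta> 0 K "n - K"] K by (simp add: sum_distrib_left[symmetric] atLeast0LessThan)
    also have "\<dots> \<le> 2 * t"
      unfolding t_def using eta_nonneg by (intro mult_left_mono sum_le_suminf summ_eta) auto
    finally show ?thesis .
  qed
  have t2: "\<bar>\<Sum>k. w (k + K)\<bar> \<le> 2 * t"
  proof -
    have bw: "\<bar>w k\<bar> \<le> 2 * \<eta> k" for k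
      using mult_mono[OF diag_weight_bounds(2) abs_Linf_le, of k k] by (simp add: abs_mult w_def)
    have "summable (\<lambda>k. \<bar>w (k + K)\<bar>)"
      using summable_weighted_Linf unfolding w_def by (rule summable_ignore_initial_segment)
    then have "\<bar>\<Sum>k. w (k + K)\<bar> \<le> (\<Sum>k. 2 * \<eta> (k + K))"
      using bw summ_eta by (intro order_trans[OF summable_rabs] suminf_le summable_mult) auto
    then show ?thesis unfolding t_def using summ_eta by (simp add: suminf_mult)
  qed
  have "(\<Sum>k<n. v k) = (\<Sum>k<K. v k) + (\<Sum>k\<in>{K..<n}. v k)"
    using K by (simp add: lessThan_atLeast0 sum.atLeastLessThan_concat)
  moreover have "suminf w = (\<Sum>k. w (k + K)) + (\<Sum>k<K. w k)"
    using summ_w by (rule suminf_split_initial_segment)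
  ultimately have "\<bar>(\<Sum>k<n. v k) - suminf w\<bar>
     \<le> 6 * suminf \<eta> * (real K / real n) + real K * (8 * C1 * \<eta> K + 2 * C2 * real n powr (- \<zeta>)) + 4 * t"
    using h t1 t2 by linarith
  moreover have "(\<Sum>k<n. v k) = (\<Sum>k<n. diag_weight k * (\<Sum>i<n - k. a i k)) / real n"
    by (simp add: v_def sum_divide_distrib)
  ultimately show ?thesis unfolding t_def w_def by (simp add: algebra_simps)
qed

text \<open>
  The cut-off \<open>K\<close> of order \<open>n powr (\<zeta> / \<psi>)\<close> balances the accumulated averaging error
  \<open>K * n powr (- \<zeta>)\<close> with the tail \<open>K powr (1 - \<psi>)\<close>.
\<close>
lemma weighted_average_bigo:
  assumes eta: "\<eta> = poly_rate A \<psi>" and \<psi>: "\<psi> > 1"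
  shows "(\<lambda>n. (\<Sum>k<n. diag_weight k * (\<Sum>i<n - k. a i k)) / real n - (\<Sum>k. diag_weight k * Linf k))
    \<in> O(\<lambda>n. real n powr (\<zeta> / \<psi> - \<zeta>))"
proof -
  define \<theta> where "\<theta> = \<zeta> / \<psi>"
  have \<theta>: "0 < \<theta>" "\<theta> < 1" "\<theta> * \<psi> = \<zeta>" using zeta \<psi> by (auto simp: \<theta>_def)
  have A: "A \<ge> 0" using eta_nonneg[of 0] by (simp add: eta poly_rate_def)
  define H where "H = suminf \<eta>"
  have H: "H \<ge> 0" unfolding H_def using eta_summable eta_nonneg by (rule suminf_nonneg)
  define B where "B = 12 * H + 8 * C1 * A + 4 * C2 + 4 * (A * (1 + 1 / (\<psi> - 1)))"
  have "\<forall>\<^sub>F n in sequentially. real n powr \<theta> + 1 < real n" using \<theta> by real_asymp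
  moreover have "\<forall>\<^sub>F n in sequentially. n \<ge> (1::nat)" by (rule eventually_ge_at_top)
  ultimately have "\<forall>\<^sub>F n in sequentially.
    norm ((\<Sum>k<n. diag_weight k * (\<Sum>i<n - k. a i k)) / real n - (\<Sum>k. diag_weight k * Linf k))
      \<le> B * norm (real n powr (\<zeta> / \<psi> - \<zeta>))"
  proof eventually_elim
    case (elim n)
    define K where "K = nat \<lceil>real n powr \<theta>\<rceil>"
    have p1: "real n powr \<theta> \<ge> 1" using elim(2) \<theta> by (simp add: ge_one_powr_ge_zero)
    have Kr: "real n powr \<theta> \<le> real K" "real K < real n powr \<theta> + 1" unfolding K_def using p1 by linarith+
    have K: "1 \<le> K" "K < n" using Kr p1 elim(1) by linarith+
    define E where "E = real n powr (\<theta> - \<zeta>)"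
    have E1: "real K * real n powr (- \<zeta>) \<le> 2 * E"
    proof -
      have "real K * real n powr (- \<zeta>) \<le> (2 * real n powr \<theta>) * real n powr (- \<zeta>)"
        using Kr p1 by (intro mult_right_mono) auto
      then show ?thesis by (simp add: E_def powr_diff powr_minus divide_inverse)
    qed
    have E2: "real K / real n \<le> 2 * E"
    proof -
      have "real K / real n = real K * real n powr (- 1)" using elim(2) by (simp add: powr_minus divide_inverse)
      also have "\<dots> \<le> real K * real n powr (- \<zeta>)"
        using elim(2) zeta by (intro mult_left_mono powr_mono) auto
      finally show ?thesis using E1 by linarith
    qed
    have E3: "real K powr (1 - \<psi>) \<le> E"
    proof -
      have "real K powr (1 - \<psi>) \<le> (real n powr \<theta>) powr (1 - \<psi>)"
        using Kr p1 \<psi> elim(2) by (intro powr_mono2') auto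
      also have "\<dots> = E" using \<theta>(3) by (simp add: E_def powr_powr right_diff_distrib)
      finally show ?thesis .
    qed
    have E4: "real K * \<eta> K \<le> A * E"
    proof -
      have "real K * \<eta> K = A * real K powr (1 - \<psi>)"
        using K by (simp add: eta poly_rate_def powr_diff powr_minus divide_inverse)
      then show ?thesis using E3 A by (simp add: mult_left_mono)
    qed
    have E5: "(\<Sum>k. \<eta> (k + K)) \<le> (A * (1 + 1 / (\<psi> - 1))) * E"
    proof -
      have "(\<Sum>k. \<eta> (k + K)) \<le> A * (1 + 1 / (\<psi> - 1)) * real K powr (1 - \<psi>)"
        unfolding eta using eta_summable by (intro poly_rate_tail_le \<psi> K A) (simp add: eta)
      also have "\<dots> \<le> A * (1 + 1 / (\<psi> - 1)) * E"
        using A \<psi> E3 by (intro mult_left_mono) auto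
      finally show ?thesis .
    qed
    have "norm ((\<Sum>k<n. diag_weight k * (\<Sum>i<n - k. a i k)) / real n - (\<Sum>k. diag_weight k * Linf k))
      \<le> 6 * H * (real K / real n) + 8 * C1 * (real K * \<eta> K) + 2 * C2 * (real K * real n powr (- \<zeta>))
      + 4 * (\<Sum>k. \<eta> (k + K))"
      using weighted_average_approx[OF K] by (simp add: H_def)
    also have "\<dots> \<le> 6 * H * (2 * E) + 8 * C1 * (A * E) + 2 * C2 * (2 * E) + 4 * ((A * (1 + 1 / (\<psi> - 1))) * E)"
      using E1 E2 E4 E5 H C1 C2 by (intro add_mono mult_left_mono) auto
    also have "\<dots> = B * norm (real n powr (\<zeta> / \<psi> - \<zeta>))"
      by (simp add: B_def E_def \<theta>_def algebra_simps)
    finally show ?case .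
  qed
  then show ?thesis by (rule bigoI)
qed

end

section \<open>Correlations along the random composition\<close>

text \<open>
  The covariance of \<open>f\<^sub>i\<close> and \<open>f\<^sub>i\<^sub>+\<^sub>k\<close> under \<open>\<mu>\<close>, split into the two functions whose averages along the
  shift are controlled separately.
\<close>
definition pair_cov :: "'x measure \<Rightarrow> ('o \<Rightarrow> 'x \<Rightarrow> 'x) \<Rightarrow> ('x \<Rightarrow> real) \<Rightarrow> nat \<Rightarrow> nat \<Rightarrow> (nat \<Rightarrow> 'o) \<Rightarrow> real" where
  "pair_cov \<mu> T f i k \<omega> = g1 \<mu> T f i k \<omega> - g2 \<mu> T f i k \<omega>"

text \<open>
  For \<open>h = 0\<close> the \<open>j\<close>-th row of the covariance matrix, folded along the diagonal. A positive \<open>h\<close> drops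
  the entries whose first index is too small for \<open>SA3\<close> to be effective.
\<close>
definition cov_row :: "'x measure \<Rightarrow> ('o \<Rightarrow> 'x \<Rightarrow> 'x) \<Rightarrow> ('x \<Rightarrow> real) \<Rightarrow> nat \<Rightarrow> nat \<Rightarrow> (nat \<Rightarrow> 'o) \<Rightarrow> real" where
  "cov_row \<mu> T f h j \<omega> = (\<Sum>i\<in>{h..j}. diag_weight (j - i) * pair_cov \<mu> T f i (j - i) \<omega>)"

lemma phi_cong:
  assumes "\<And>m. 1 \<le> m \<Longrightarrow> m \<le> n \<Longrightarrow> \<omega> m = \<omega>' m"
  shows "phi T n \<omega> = phi T n \<omega>'"
  using assms by (induction n) auto

lemma pair_cov_cong:
  assumes "\<And>m. 1 \<le> m \<Longrightarrow> m \<le> i + k \<Longrightarrow> \<omega> m = \<omega>' m"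
  shows "pair_cov \<mu> T f i k \<omega> = pair_cov \<mu> T f i k \<omega>'"
proof -
  have "phi T i \<omega> = phi T i \<omega>'" "phi T (i + k) \<omega> = phi T (i + k) \<omega>'"
    using assms by (auto intro!: phi_cong)
  then show ?thesis by (simp add: pair_cov_def g1_def g2_def obs_def)
qed

lemma cov_row_cong:
  assumes "\<And>m. 1 \<le> m \<Longrightarrow> m \<le> j \<Longrightarrow> \<omega> m = \<omega>' m"
  shows "cov_row \<mu> T f h j \<omega> = cov_row \<mu> T f h j \<omega>'"
  unfolding cov_row_def using assms by (intro sum.cong refl arg_cong2[of _ _ _ _ "(*)"] pair_cov_cong) auto

lemma phi_add: "phi T (m + r) \<omega> x = phi T m ((shift ^^ r) \<omega>) (phi T r \<omega> x)"
  by (induction m) (simp_all add: shift_funpow_apply)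

lemma symmetric_double_sum:
  fixes s :: "nat \<Rightarrow> nat \<Rightarrow> real"
  assumes "\<And>i j. s i j = s j i"
  shows "(\<Sum>i<n. \<Sum>j<n. s i j) = (\<Sum>j<n. \<Sum>i\<in>{0..j}. diag_weight (j - i) * s i j)"
proof (induction n)
  case (Suc n)
  have "(\<Sum>i\<in>{0..n}. diag_weight (n - i) * s i n) = (\<Sum>i<n. 2 * s i n) + s n n"
  proof -
    have "{0..n} = insert n {..<n}" by auto
    then show ?thesis by (simp add: diag_weight_def)
  qed
  moreover have "(\<Sum>j<n. s n j) = (\<Sum>i<n. s i n)" using assms by simp
  ultimately show ?case using Suc.IH
    by (simp add: sum.distrib sum_distrib_left[symmetric])
qed simp

context random_composition
begin

sublocale P: prob_space P by (rule prob_P)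
sublocale mu: prob_space \<mu> by (rule prob_mu)

lemma space_P: "space P = space (seq_space M0)"
  using sets_P by (rule sets_eq_imp_space_eq)

lemma borel_measurable_P: "borel_measurable P = borel_measurable (seq_space M0)"
  by (rule measurable_cong_sets[OF sets_P refl])

definition fbound :: real where
  "fbound = (SOME K. \<forall>x\<in>space \<mu>. \<bar>f x\<bar> \<le> K)"

lemma fbound: "x \<in> space \<mu> \<Longrightarrow> \<bar>f x\<bar> \<le> fbound"
  using someI_ex[OF bounded_f] by (simp add: fbound_def)

lemma fbound_nonneg: "0 \<le> fbound"
  using mu.not_empty fbound abs_ge_zero order_trans by blast

lemma measurable_phi_fibre:
  assumes "\<omega> \<in> space (seq_space M0)"
  shows "phi T n \<omega> \<in> measurable \<mu> \<mu>"
proof (induction n)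
  case (Suc n)
  have "\<omega> (Suc n) \<in> space M0" using assms by (auto simp: space_PiM)
  then show ?case unfolding phi.simps by (rule measurable_comp[OF Suc.IH measurable_T])
qed (simp add: id_def)

lemma measurable_obs:
  assumes "\<omega> \<in> space (seq_space M0)"
  shows "obs T f i \<omega> \<in> borel_measurable \<mu>"
  unfolding obs_def using measurable_phi_fibre[OF assms] measurable_f by (rule measurable_comp)

lemma abs_obs_le:
  assumes "\<omega> \<in> space (seq_space M0)" "x \<in> space \<mu>"
  shows "\<bar>obs T f i \<omega> x\<bar> \<le> fbound"
  unfolding obs_def using fbound measurable_space[OF measurable_phi_fibre[OF assms(1)] assms(2)] by simp

lemma integrable_obs:
  assumes "\<omega> \<in> space (seq_space M0)"
  shows "integrable \<mu> (obs T f i \<omega>)"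
  by (rule mu.integrable_const_bound[where B=fbound]) (use abs_obs_le[OF assms] measurable_obs[OF assms] in auto)

lemma abs_obs_mult_le:
  assumes "\<omega> \<in> space (seq_space M0)" "x \<in> space \<mu>"
  shows "\<bar>obs T f i \<omega> x * obs T f j \<omega> x\<bar> \<le> fbound * fbound"
  unfolding abs_mult using abs_obs_le[OF assms] fbound_nonneg by (intro mult_mono) auto

lemma integrable_obs_mult:
  assumes "\<omega> \<in> space (seq_space M0)"
  shows "integrable \<mu> (\<lambda>x. obs T f i \<omega> x * obs T f j \<omega> x)"
  by (rule mu.integrable_const_bound[where B="fbound * fbound"])
     (use abs_obs_mult_le[OF assms] measurable_obs[OF assms] in auto)

lemma abs_integral_mu_le:
  fixes g :: "'x \<Rightarrow> real"
  assumes "\<And>x. x \<in> space \<mu> \<Longrightarrow> \<bar>g x\<bar> \<le> K" "integrable \<mu> g"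
  shows "\<bar>\<integral>x. g x \<partial>\<mu>\<bar> \<le> K"
  using mu.integral_diff_le[of g "\<lambda>_. 0" K] assms by auto

lemma abs_mean_obs_le:
  "\<omega> \<in> space (seq_space M0) \<Longrightarrow> \<bar>\<integral>x. obs T f i \<omega> x \<partial>\<mu>\<bar> \<le> fbound"
  by (intro abs_integral_mu_le abs_obs_le integrable_obs)

lemma measurable_obs_joint:
  "(\<lambda>(\<omega>, x). obs T f i \<omega> x) \<in> borel_measurable (seq_space M0 \<Otimes>\<^sub>M \<mu>)"
  using measurable_compose[OF measurable_phi[of i] measurable_f] by (simp add: obs_def case_prod_unfold)

lemma measurable_g1 [measurable]: "g1 \<mu> T f r k \<in> borel_measurable (seq_space M0)"
proof -
  have "(\<lambda>(\<omega>, x). obs T f r \<omega> x * obs T f (r + k) \<omega> x) \<in> borel_measurable (seq_space M0 \<Otimes>\<^sub>M \<mu>)"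
    using borel_measurable_times[OF measurable_obs_joint[of r] measurable_obs_joint[of "r + k"]]
    by (simp add: case_prod_unfold)
  then show ?thesis unfolding g1_def by (rule mu.borel_measurable_lebesgue_integral)
qed

lemma measurable_g2 [measurable]: "g2 \<mu> T f r k \<in> borel_measurable (seq_space M0)"
  unfolding g2_def
  by (intro borel_measurable_times mu.borel_measurable_lebesgue_integral measurable_obs_joint)

lemma measurable_pair_cov [measurable]: "pair_cov \<mu> T f i k \<in> borel_measurable (seq_space M0)"
  unfolding pair_cov_def by measurable

lemma measurable_cov_row [measurable]: "cov_row \<mu> T f h j \<in> borel_measurable (seq_space M0)"
  unfolding cov_row_def by measurable

lemma abs_g1_le: "\<omega> \<in> space (seq_space M0) \<Longrightarrow> \<bar>g1 \<mu> T f r k \<omega>\<bar> \<le> fbound * fbound"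
  unfolding g1_def by (intro abs_integral_mu_le abs_obs_mult_le integrable_obs_mult)

lemma abs_g2_le: "\<omega> \<in> space (seq_space M0) \<Longrightarrow> \<bar>g2 \<mu> T f r k \<omega>\<bar> \<le> fbound * fbound"
  unfolding g2_def abs_mult using abs_mean_obs_le fbound_nonneg by (intro mult_mono) auto

lemma pair_cov_eq:
  assumes \<omega>: "\<omega> \<in> space (seq_space M0)"
  shows "(\<integral>x. centred_obs \<mu> T f i \<omega> x * centred_obs \<mu> T f (i + k) \<omega> x \<partial>\<mu>) = pair_cov \<mu> T f i k \<omega>"
proof -
  let ?m = "\<lambda>i. \<integral>x. obs T f i \<omega> x \<partial>\<mu>"
  have "centred_obs \<mu> T f i \<omega> x * centred_obs \<mu> T f (i + k) \<omega> x
      = obs T f i \<omega> x * obs T f (i + k) \<omega> x - ?m (i + k) * obs T f i \<omega> x - ?m i * obs T f (i + k) \<omega> x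
        + ?m i * ?m (i + k)" for x
    by (simp add: centred_obs_def algebra_simps)
  then show ?thesis
    using integrable_obs[OF \<omega>] integrable_obs_mult[OF \<omega>]
    by (simp add: pair_cov_def g1_def g2_def mu.prob_space)
qed

lemma sigma_n_sq_eq_cov_rows:
  assumes \<omega>: "\<omega> \<in> space (seq_space M0)"
  shows "sigma_n_sq \<mu> T f n \<omega> = (\<Sum>j<n. cov_row \<mu> T f 0 j \<omega>) / real n"
proof -
  let ?s = "\<lambda>i j. \<integral>x. centred_obs \<mu> T f i \<omega> x * centred_obs \<mu> T f j \<omega> x \<partial>\<mu>"
  have "(\<Sum>i<n. \<Sum>j<n. ?s i j) = (\<Sum>j<n. \<Sum>i\<in>{0..j}. diag_weight (j - i) * ?s i j)"
    by (rule symmetric_double_sum) (simp add: mult.commute)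
  also have "\<dots> = (\<Sum>j<n. cov_row \<mu> T f 0 j \<omega>)"
    unfolding cov_row_def
  proof (intro sum.cong refl arg_cong2[of _ _ _ _ "(*)"])
    fix i j :: nat assume "i \<in> {0..j}"
    then show "?s i j = pair_cov \<mu> T f i (j - i) \<omega>" using pair_cov_eq[OF \<omega>, of i "j - i"] by simp
  qed
  finally show ?thesis by (simp add: sigma_n_sq_def)
qed

lemma sigma_n_sq_nonneg:
  assumes \<omega>: "\<omega> \<in> space (seq_space M0)"
  shows "0 \<le> sigma_n_sq \<mu> T f n \<omega>"
proof -
  let ?c = "\<lambda>i x. centred_obs \<mu> T f i \<omega> x"
  have int: "integrable \<mu> (\<lambda>x. ?c i x * ?c j x)" for i j
  proof -
    let ?m = "\<lambda>i. \<integral>x. obs T f i \<omega> x \<partial>\<mu>"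
    have "?c i x * ?c j x = obs T f i \<omega> x * obs T f j \<omega> x - ?m j * obs T f i \<omega> x - ?m i * obs T f j \<omega> x
        + ?m i * ?m j" for x
      by (simp add: centred_obs_def algebra_simps)
    then show ?thesis using integrable_obs[OF \<omega>] integrable_obs_mult[OF \<omega>] by simp
  qed
  have "(\<integral>x. (\<Sum>i<n. ?c i x)\<^sup>2 \<partial>\<mu>) = (\<integral>x. (\<Sum>i<n. \<Sum>j<n. ?c i x * ?c j x) \<partial>\<mu>)"
    by (simp add: power2_eq_square sum_product)
  also have "\<dots> = (\<Sum>i<n. \<Sum>j<n. \<integral>x. ?c i x * ?c j x \<partial>\<mu>)"
    by (simp add: Bochner_Integration.integral_sum Bochner_Integration.integrable_sum int)
  finally have "(\<Sum>i<n. \<Sum>j<n. \<integral>x. ?c i x * ?c j x \<partial>\<mu>) \<ge> 0"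
    by (metis (no_types, lifting) Bochner_Integration.integral_nonneg zero_le_power2)
  then show ?thesis by (simp add: sigma_n_sq_def)
qed

lemma SA1_pair_cov:
  assumes "SA1 P \<mu> T f \<eta>"
  shows "AE \<omega> in P. \<forall>i k. \<bar>pair_cov \<mu> T f i k \<omega>\<bar> \<le> \<eta> k"
proof -
  have "AE \<omega> in P. \<forall>i j. \<bar>\<integral>x. centred_obs \<mu> T f i \<omega> x * centred_obs \<mu> T f j \<omega> x \<partial>\<mu>\<bar>
      \<le> \<eta> (nat \<bar>int i - int j\<bar>)"
    using assms by (simp add: SA1_def)
  then show ?thesis using AE_space
  proof eventually_elim
    case (elim \<omega>)
    show ?case
    proof (intro allI)
      fix i k
      have "\<bar>pair_cov \<mu> T f i k \<omega>\<bar> \<le> \<eta> (nat \<bar>int i - int (i + k)\<bar>)"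
        using elim pair_cov_eq[of \<omega> i k] by (metis space_P)
      then show "\<bar>pair_cov \<mu> T f i k \<omega>\<bar> \<le> \<eta> k" by simp
    qed
  qed
qed

text \<open>
  The mean of the product and the two single means are all of the form whose dependence on the first
  \<open>i\<close> maps \<open>SA3\<close> controls. In the product of the two means one factor is exchanged at a
  time, the other being at most \<open>fbound\<close>.
\<close>
lemma SA3_pair_cov:
  assumes "SA3 P \<mu> T f \<eta>" and \<eta>: "\<And>n. 0 \<le> \<eta> n"
  shows "\<exists>C1\<ge>0. AE \<omega> in P. \<forall>r i k.
    \<bar>pair_cov \<mu> T f (r + i) k \<omega> - pair_cov \<mu> T f r k ((shift ^^ i) \<omega>)\<bar> \<le> C1 * \<eta> r"
proof -
  obtain C where C: "C \<ge> 0" and AE: "AE \<omega> in P. \<forall>k. \<forall>r\<le>k.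
        \<forall>g \<in> range (\<lambda>m. obs T f m ((shift ^^ k) \<omega>)) \<union>
              range (\<lambda>m x. f x * obs T f m ((shift ^^ k) \<omega>) x).
          \<bar>(\<integral>x. g (phi T k \<omega> x) \<partial>\<mu>) - (\<integral>x. g (phi T (k - r) ((shift ^^ r) \<omega>) x) \<partial>\<mu>)\<bar>
            \<le> C * \<eta> (k - r)"
    using assms(1) unfolding SA3_def by blast
  define C1 where "C1 = C + 2 * fbound * C"
  have "AE \<omega> in P. \<forall>r i k.
    \<bar>pair_cov \<mu> T f (r + i) k \<omega> - pair_cov \<mu> T f r k ((shift ^^ i) \<omega>)\<bar> \<le> C1 * \<eta> r"
    using AE AE_space
  proof eventually_elim
    case (elim \<omega>)
    have \<omega>: "\<omega> \<in> space (seq_space M0)" using elim(2) by (simp add: space_P)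
    show ?case
    proof (intro allI)
      fix r i k
      let ?\<omega>' = "(shift ^^ i) \<omega>" and ?\<omega>'' = "(shift ^^ (r + i)) \<omega>"
      have \<omega>': "?\<omega>' \<in> space (seq_space M0)" by (rule measurable_space[OF measurable_shift_funpow \<omega>])
      have comp: "(shift ^^ r) ?\<omega>' = ?\<omega>''" by (simp add: funpow_add)
      let ?M = "\<lambda>\<omega> j. \<integral>x. obs T f j \<omega> x \<partial>\<mu>"
      have use: "\<bar>(\<integral>x. g (phi T (r + i) \<omega> x) \<partial>\<mu>) - (\<integral>x. g (phi T r ?\<omega>' x) \<partial>\<mu>)\<bar> \<le> C * \<eta> r"
        if "g \<in> range (\<lambda>m. obs T f m ?\<omega>'') \<union> range (\<lambda>m x. f x * obs T f m ?\<omega>'' x)" for g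
        using elim(1)[rule_format, of i "r + i" g] that by simp
      have obs1: "obs T f m ?\<omega>'' (phi T (r + i) \<omega> x) = obs T f (r + i + m) \<omega> x" for m x
        using phi_add[of T m "r + i" \<omega> x] by (simp add: obs_def add.commute add.left_commute)
      have obs2: "obs T f m ?\<omega>'' (phi T r ?\<omega>' x) = obs T f (r + m) ?\<omega>' x" for m x
        using phi_add[of T m r ?\<omega>' x] unfolding comp by (simp add: obs_def add.commute)
      have mean: "\<bar>?M \<omega> (r + i + m) - ?M ?\<omega>' (r + m)\<bar> \<le> C * \<eta> r" for m
        using use[of "obs T f m ?\<omega>''"] by (simp add: obs1 obs2)
      have "\<bar>g1 \<mu> T f (r + i) k \<omega> - g1 \<mu> T f r k ?\<omega>'\<bar> \<le> C * \<eta> r"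
        using use[of "\<lambda>x. f x * obs T f k ?\<omega>'' x"] unfolding obs1 obs2 by (simp add: g1_def obs_def)
      moreover have "\<bar>g2 \<mu> T f (r + i) k \<omega> - g2 \<mu> T f r k ?\<omega>'\<bar> \<le> 2 * fbound * (C * \<eta> r)"
      proof -
        have "g2 \<mu> T f (r + i) k \<omega> - g2 \<mu> T f r k ?\<omega>'
          = ?M \<omega> (r + i) * (?M \<omega> (r + i + k) - ?M ?\<omega>' (r + k)) + ?M ?\<omega>' (r + k) * (?M \<omega> (r + i) - ?M ?\<omega>' r)"
          by (simp add: g2_def algebra_simps)
        also have "\<bar>\<dots>\<bar> \<le> fbound * (C * \<eta> r) + fbound * (C * \<eta> r)"
          using mean[of k] mean[of 0] abs_mean_obs_le[OF \<omega>] abs_mean_obs_le[OF \<omega>'] fbound_nonneg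
          by (intro order_trans[OF abs_triangle_ineq] add_mono)
            (auto simp only: abs_mult add_0_right intro!: mult_mono)
        finally show ?thesis by linarith
      qed
      ultimately show "\<bar>pair_cov \<mu> T f (r + i) k \<omega> - pair_cov \<mu> T f r k ?\<omega>'\<bar> \<le> C1 * \<eta> r"
        unfolding pair_cov_def C1_def by (simp add: algebra_simps)
    qed
  qed
  moreover have "C1 \<ge> 0" using C fbound_nonneg by (simp add: C1_def)
  ultimately show ?thesis by blast
qed

end

section \<open>Decay of correlations between the rows\<close>

lemma sum_le_suminf_reflect:
  fixes \<eta> :: "nat \<Rightarrow> real"
  assumes summ: "summable \<eta>" and \<eta>: "\<And>k. 0 \<le> \<eta> k" and I: "finite I" "\<And>i. i \<in> I \<Longrightarrow> i + q \<le> j"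
  shows "(\<Sum>i\<in>I. \<eta> (j - i)) \<le> (\<Sum>k. \<eta> (k + q))"
proof -
  have inj: "inj_on (\<lambda>i. j - i - q) I"
  proof (rule inj_onI)
    fix i i' assume "i \<in> I" "i' \<in> I" "j - i - q = j - i' - q"
    then show "i = i'" using I(2)[of i] I(2)[of i'] by linarith
  qed
  have "(\<Sum>i\<in>I. \<eta> (j - i)) = (\<Sum>i\<in>I. \<eta> ((j - i - q) + q))"
  proof (rule sum.cong)
    fix i assume "i \<in> I"
    then have "j - i - q + q = j - i" using I(2)[of i] by linarith
    then show "\<eta> (j - i) = \<eta> (j - i - q + q)" by simp
  qed simp
  also have "\<dots> = (\<Sum>k\<in>(\<lambda>i. j - i - q) ` I. \<eta> (k + q))"
    using inj by (simp add: sum.reindex)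
  also have "\<dots> \<le> (\<Sum>k. \<eta> (k + q))"
    using summ \<eta> I(1) by (intro sum_le_suminf summable_ignore_initial_segment) auto
  finally show ?thesis .
qed

lemma (in prob_space) covariance_perturb:
  fixes X Y Y' :: "'a \<Rightarrow> real"
  assumes [measurable]: "X \<in> borel_measurable M" "Y \<in> borel_measurable M" "Y' \<in> borel_measurable M"
    and X: "AE \<omega> in M. \<bar>X \<omega>\<bar> \<le> B" and Y: "AE \<omega> in M. \<bar>Y \<omega>\<bar> \<le> B" and Y': "AE \<omega> in M. \<bar>Y' \<omega>\<bar> \<le> B"
    and d: "AE \<omega> in M. \<bar>Y \<omega> - Y' \<omega>\<bar> \<le> e" and B: "B \<ge> 0"
  shows "\<bar>((\<integral>\<omega>. X \<omega> * Y \<omega> \<partial>M) - (\<integral>\<omega>. X \<omega> \<partial>M) * (\<integral>\<omega>. Y \<omega> \<partial>M))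
    - ((\<integral>\<omega>. X \<omega> * Y' \<omega> \<partial>M) - (\<integral>\<omega>. X \<omega> \<partial>M) * (\<integral>\<omega>. Y' \<omega> \<partial>M))\<bar> \<le> 2 * B * e"
proof -
  have i: "integrable M Z" if "Z \<in> borel_measurable M" "AE \<omega> in M. \<bar>Z \<omega>\<bar> \<le> B" for Z :: "'a \<Rightarrow> real"
    using that by (intro integrable_const_bound[where B=B]) auto
  have ii: "integrable M (\<lambda>\<omega>. X \<omega> * Z \<omega>)"
    if [measurable]: "Z \<in> borel_measurable M" and Z: "AE \<omega> in M. \<bar>Z \<omega>\<bar> \<le> B" for Z :: "'a \<Rightarrow> real"
  proof (rule integrable_const_bound[where B="B * B"])
    show "AE \<omega> in M. norm (X \<omega> * Z \<omega>) \<le> B * B"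
      using X Z by eventually_elim (use B in \<open>simp add: abs_mult mult_mono\<close>)
  qed simp
  have "\<bar>(\<integral>\<omega>. X \<omega> * Y \<omega> \<partial>M) - (\<integral>\<omega>. X \<omega> * Y' \<omega> \<partial>M)\<bar> \<le> B * e"
  proof (rule integral_diff_le[OF ii ii])
    show "AE \<omega> in M. \<bar>X \<omega> * Y \<omega> - X \<omega> * Y' \<omega>\<bar> \<le> B * e"
      using X d by eventually_elim (use B in \<open>simp add: right_diff_distrib[symmetric] abs_mult mult_mono\<close>)
  qed (use Y Y' in auto)
  moreover have "\<bar>(\<integral>\<omega>. X \<omega> \<partial>M) * ((\<integral>\<omega>. Y \<omega> \<partial>M) - (\<integral>\<omega>. Y' \<omega> \<partial>M))\<bar> \<le> B * e"
  proof -
    have X0: "AE \<omega> in M. \<bar>X \<omega> - 0\<bar> \<le> B" using X by simp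
    have "\<bar>(\<integral>\<omega>. X \<omega> \<partial>M) - (\<integral>\<omega>. 0 \<partial>M)\<bar> \<le> B"
      by (rule integral_diff_le[OF i _ X0]) (use X in simp_all)
    then have EX: "\<bar>\<integral>\<omega>. X \<omega> \<partial>M\<bar> \<le> B" by simp
    have EY: "\<bar>(\<integral>\<omega>. Y \<omega> \<partial>M) - (\<integral>\<omega>. Y' \<omega> \<partial>M)\<bar> \<le> e"
      by (rule integral_diff_le[OF i i d]) (use Y Y' in simp_all)
    show ?thesis unfolding abs_mult by (rule mult_mono[OF EX EY B abs_ge_zero])
  qed
  ultimately show ?thesis unfolding right_diff_distrib by linarith
qed

lemma sum_inj_le_sum_lessThan:
  fixes \<rho> :: "nat \<Rightarrow> real"
  assumes "inj_on g J" "g ` J \<subseteq> {..<n}" "\<And>d. 0 \<le> \<rho> d"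
  shows "(\<Sum>j\<in>J. \<rho> (g j)) \<le> (\<Sum>d<n. \<rho> d)"
proof -
  have "(\<Sum>j\<in>J. \<rho> (g j)) = (\<Sum>d\<in>g ` J. \<rho> d)" using assms(1) by (simp add: sum.reindex)
  also have "\<dots> \<le> (\<Sum>d<n. \<rho> d)" using assms by (intro sum_mono2) auto
  finally show ?thesis .
qed

text \<open>
  Within a block, an index has at most two partners at each distance \<open>d < n\<close>.
\<close>
lemma (in prob_space) block_variance_le:
  fixes X :: "nat \<Rightarrow> 'a \<Rightarrow> real"
  assumes [measurable]: "\<And>i. X i \<in> borel_measurable M"
    and X: "\<And>i. AE \<omega> in M. \<bar>X i \<omega>\<bar> \<le> B" and B: "B \<ge> 0"
    and cov: "\<And>i d. \<bar>(\<integral>\<omega>. X i \<omega> * X (i + d) \<omega> \<partial>M) - (\<integral>\<omega>. X i \<omega> \<partial>M) * (\<integral>\<omega>. X (i + d) \<omega> \<partial>M)\<bar> \<le> \<rho> d"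
  shows "integrable M (\<lambda>\<omega>. (\<Sum>i\<in>{m..<m + n}. X i \<omega> - (\<integral>\<omega>. X i \<omega> \<partial>M))\<^sup>2)"
    and "(\<integral>\<omega>. (\<Sum>i\<in>{m..<m + n}. X i \<omega> - (\<integral>\<omega>. X i \<omega> \<partial>M))\<^sup>2 \<partial>M) \<le> real n * (2 * (\<Sum>d<n. \<rho> d))"
proof -
  let ?I = "{m..<m + n}"
  define E where "E i = (\<integral>\<omega>. X i \<omega> \<partial>M)" for i
  define c where "c i j = (\<integral>\<omega>. X i \<omega> * X j \<omega> \<partial>M) - E i * E j" for i j
  have \<rho>: "0 \<le> \<rho> d" for d using cov[of 0 d] abs_ge_zero order_trans by blast
  have i1: "integrable M (X i)" for i
    using X[of i] by (intro integrable_const_bound[where B=B]) auto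
  have i2: "integrable M (\<lambda>\<omega>. X i \<omega> * X j \<omega>)" for i j
  proof (rule integrable_const_bound[where B="B * B"])
    show "AE \<omega> in M. norm (X i \<omega> * X j \<omega>) \<le> B * B"
      using X[of i] X[of j] by eventually_elim (use B in \<open>simp add: abs_mult mult_mono\<close>)
  qed simp
  have expand: "(X i \<omega> - E i) * (X j \<omega> - E j) = X i \<omega> * X j \<omega> - E j * X i \<omega> - E i * X j \<omega> + E i * E j" for i j \<omega>
    by (simp add: algebra_simps)
  have i3: "integrable M (\<lambda>\<omega>. (X i \<omega> - E i) * (X j \<omega> - E j))" for i j
    unfolding expand using i1 i2 by simp
  have e3: "(\<integral>\<omega>. (X i \<omega> - E i) * (X j \<omega> - E j) \<partial>M) = c i j" for i j
    unfolding expand using i1 i2 by (simp add: c_def E_def prob_space)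
  have sq: "(\<Sum>i\<in>?I. X i \<omega> - E i)\<^sup>2 = (\<Sum>i\<in>?I. \<Sum>j\<in>?I. (X i \<omega> - E i) * (X j \<omega> - E j))" for \<omega>
    by (simp add: power2_eq_square sum_product)
  show "integrable M (\<lambda>\<omega>. (\<Sum>i\<in>?I. X i \<omega> - (\<integral>\<omega>. X i \<omega> \<partial>M))\<^sup>2)"
    unfolding E_def[symmetric] sq by (intro Bochner_Integration.integrable_sum i3)
  have c: "\<bar>c i (i + d)\<bar> \<le> \<rho> d" for i d using cov by (simp add: c_def E_def)
  have c_commute: "c i j = c j i" for i j by (simp add: c_def mult.commute)
  have inner: "(\<Sum>j\<in>?I. c i j) \<le> 2 * (\<Sum>d<n. \<rho> d)" if i: "i \<in> ?I" for i
  proof -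
    have "?I = {m..<i} \<union> {i..<m + n}" using i by auto
    then have "(\<Sum>j\<in>?I. c i j) = (\<Sum>j\<in>{m..<i}. c i j) + (\<Sum>j\<in>{i..<m + n}. c i j)"
      by (simp add: sum.union_disjoint)
    also have "\<dots> \<le> (\<Sum>j\<in>{m..<i}. \<rho> (i - j)) + (\<Sum>j\<in>{i..<m + n}. \<rho> (j - i))"
    proof (intro add_mono sum_mono)
      fix j assume "j \<in> {m..<i}"
      then show "c i j \<le> \<rho> (i - j)" using c[of j "i - j"] c_commute[of i j] by simp
    next
      fix j assume "j \<in> {i..<m + n}"
      then show "c i j \<le> \<rho> (j - i)" using c[of i "j - i"] by simp
    qed
    also have "\<dots> \<le> (\<Sum>d<n. \<rho> d) + (\<Sum>d<n. \<rho> d)"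
      using i by (intro add_mono sum_inj_le_sum_lessThan \<rho>) (auto simp: inj_on_def)
    finally show ?thesis by simp
  qed
  have "(\<integral>\<omega>. (\<Sum>i\<in>?I. X i \<omega> - E i)\<^sup>2 \<partial>M) = (\<Sum>i\<in>?I. \<Sum>j\<in>?I. c i j)"
    unfolding sq by (simp add: Bochner_Integration.integral_sum Bochner_Integration.integrable_sum i3 e3)
  also have "\<dots> \<le> (\<Sum>i\<in>?I. 2 * (\<Sum>d<n. \<rho> d))" by (intro sum_mono inner)
  finally show "(\<integral>\<omega>. (\<Sum>i\<in>?I. X i \<omega> - (\<integral>\<omega>. X i \<omega> \<partial>M))\<^sup>2 \<partial>M) \<le> real n * (2 * (\<Sum>d<n. \<rho> d))"
    unfolding E_def[symmetric] by simp
qed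

text \<open>
  Lowering the exponent \<open>m\<close> to \<open>m'\<close> avoids the logarithm at \<open>m = 1\<close>, and replaces every \<open>m > 1\<close>
  by the borderline \<open>m' = 1\<close>, where the sums stay bounded.
\<close>
lemma sum_poly_rate_le:
  assumes C: "C \<ge> 0" and m': "0 < m'" "m' \<le> 1" "m' \<le> m" "m' = 1 \<longrightarrow> 1 < m"
  shows "\<exists>C'\<ge>0. \<forall>n\<ge>1. (\<Sum>d<n. poly_rate C m d) \<le> C' * real n powr (1 - m')"
proof -
  have split: "(\<Sum>d<n. poly_rate C m d) = C * (1 + (\<Sum>d\<in>{1..<n}. real d powr (- m)))" if n: "n \<ge> 1" for n
  proof -
    \<comment> \<open>The term at distance zero is \<open>C\<close>, not \<open>0 powr (- m) = 0\<close>.\<close>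
    have "{..<n} = insert 0 {1..<n}" using n by auto
    then show ?thesis by (simp add: poly_rate_def distrib_left sum_distrib_left)
  qed
  show ?thesis
  proof (cases "m' = 1")
    case True
    then have m: "m > 1" using m' by auto
    have "(\<Sum>d<n. poly_rate C m d) \<le> C * (1 + (1 + 1 / (m - 1))) * real n powr (1 - m')" if n: "n \<ge> 1" for n
      using sum_powr_tail_le[OF m, of 1 n] C n unfolding split[OF n] True
      by (simp add: mult_left_mono)
    then show ?thesis using C m by (intro exI[of _ "C * (1 + (1 + 1 / (m - 1)))"]) auto
  next
    case False
    then have m1: "m' < 1" using m' by auto
    have "(\<Sum>d<n. poly_rate C m d) \<le> C * (1 + 1 / (1 - m')) * real n powr (1 - m')" if n: "n \<ge> 1" for n
    proof -
      have "(\<Sum>d\<in>{1..<n}. real d powr (- m)) \<le> (\<Sum>d\<in>{1..<n}. real d powr (- m'))"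
        using m' by (intro sum_mono powr_mono) auto
      also have "\<dots> \<le> (\<Sum>d=1..n. real d powr (- m'))" by (intro sum_mono2) auto
      also have "\<dots> \<le> real n powr (1 - m') / (1 - m')" using m'(1) m1 by (rule sum_powr_le)
      finally have "1 + (\<Sum>d\<in>{1..<n}. real d powr (- m)) \<le> (1 + 1 / (1 - m')) * real n powr (1 - m')"
        using ge_one_powr_ge_zero[of "real n" "1 - m'"] n m1 by (simp add: distrib_right)
      then show ?thesis unfolding split[OF n] using C by (simp add: mult_left_mono mult.assoc)
    qed
    then show ?thesis using C m1 by (intro exI[of _ "C * (1 + 1 / (1 - m'))"]) auto
  qed
qed

locale mixing_composition = random_composition M0 P \<mu> T f
  for M0 :: "'o measure" and P :: "(nat \<Rightarrow> 'o) measure" and \<mu> :: "'x measure"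
    and T :: "'o \<Rightarrow> 'x \<Rightarrow> 'x" and f :: "'x \<Rightarrow> real" +
  fixes A A' \<psi> \<gamma> :: real
  assumes psi: "\<psi> > 1" and gamma: "\<gamma> > 0"
    and SA1: "SA1 P \<mu> T f (poly_rate A \<psi>)"
    and SA2: "SA2 M0 P (\<lambda>n. A' * real n powr (- \<gamma>))"
    and SA3: "SA3 P \<mu> T f (poly_rate A \<psi>)"
begin

abbreviation "\<eta> \<equiv> poly_rate A \<psi>"

lemma eta_props: "antimono \<eta>" "0 \<le> \<eta> n" "summable \<eta>"
  using SA1 by (auto simp: SA1_def)

lemma A_nonneg: "A \<ge> 0"
  using eta_props(2)[of 0] by (simp add: poly_rate_def)

lemma mixing_coefficient:
  assumes "n \<ge> 1" "i \<ge> 1" "U \<in> coord_sigma M0 {1..i}" "V \<in> coord_sigma M0 {i + n..}"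
  shows "\<bar>P.prob (U \<inter> V) - P.prob U * P.prob V\<bar> \<le> A' * real n powr (- \<gamma>)"
  using SA2 assms unfolding SA2_def by blast

lemma A'_nonneg: "A' \<ge> 0"
proof -
  have "{} \<in> coord_sigma M0 I" for I unfolding coord_sigma_def by (rule sigma_sets.Empty)
  then show ?thesis using mixing_coefficient[of 1 1 "{}" "{}"] by simp
qed

lemma abs_cov_row_le:
  assumes "\<forall>i k. \<bar>pair_cov \<mu> T f i k \<omega>\<bar> \<le> \<eta> k"
  shows "\<bar>cov_row \<mu> T f h j \<omega>\<bar> \<le> 2 * suminf \<eta>"
proof -
  have "\<bar>cov_row \<mu> T f h j \<omega>\<bar> \<le> (\<Sum>i\<in>{h..j}. 2 * \<eta> (j - i))"
    unfolding cov_row_def using assms diag_weight_bounds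
    by (intro order_trans[OF sum_abs] sum_mono) (simp add: abs_mult mult_mono)
  also have "\<dots> = 2 * (\<Sum>i\<in>{h..j}. \<eta> (j - i))" by (simp add: sum_distrib_left)
  also have "\<dots> \<le> 2 * (\<Sum>k. \<eta> (k + 0))"
    by (intro mult_left_mono sum_le_suminf_reflect eta_props) auto
  finally show ?thesis by simp
qed

lemma AE_abs_cov_row_le: "AE \<omega> in P. \<bar>cov_row \<mu> T f h j \<omega>\<bar> \<le> 2 * suminf \<eta>"
  using SA1_pair_cov[OF SA1] by eventually_elim (rule abs_cov_row_le)

text \<open>
  The first \<open>h + r\<close> entries of the row are at distance more than \<open>q\<close> from the diagonal and are dropped.
  In each of the remaining \<open>q + 1\<close> entries the composition is started at time \<open>r\<close> instead of \<open>0\<close>; at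
  least \<open>h\<close> steps remain before the first observation.
\<close>
lemma cov_row_shift_approx:
  assumes s1: "\<forall>i k. \<bar>pair_cov \<mu> T f i k \<omega>\<bar> \<le> \<eta> k"
    and s3: "\<forall>r i k. \<bar>pair_cov \<mu> T f (r + i) k \<omega> - pair_cov \<mu> T f r k ((shift ^^ i) \<omega>)\<bar> \<le> C1 * \<eta> r"
    and C1: "C1 \<ge> 0" and j: "j = h + r + q"
  shows "\<bar>cov_row \<mu> T f 0 j \<omega> - cov_row \<mu> T f h (j - r) ((shift ^^ r) \<omega>)\<bar>
    \<le> 2 * (\<Sum>k. \<eta> (k + q)) + 2 * (real q + 1) * (C1 * \<eta> h)"
proof -
  let ?t = "\<lambda>i. diag_weight (j - i) * pair_cov \<mu> T f i (j - i) \<omega>"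
  have "{0..j} = {0..<h + r} \<union> {h + r..j}" using j by auto
  then have "cov_row \<mu> T f 0 j \<omega> = (\<Sum>i\<in>{0..<h + r} \<union> {h + r..j}. ?t i)"
    unfolding cov_row_def by (rule arg_cong)
  also have "\<dots> = (\<Sum>i\<in>{0..<h + r}. ?t i) + (\<Sum>i\<in>{h + r..j}. ?t i)"
    by (rule sum.union_disjoint) auto
  finally have split: "cov_row \<mu> T f 0 j \<omega> = \<dots>" .
  have "\<bar>\<Sum>i\<in>{0..<h + r}. ?t i\<bar> \<le> (\<Sum>i\<in>{0..<h + r}. 2 * \<eta> (j - i))"
    using s1 diag_weight_bounds
    by (intro order_trans[OF sum_abs] sum_mono) (simp add: abs_mult mult_mono)
  also have "\<dots> = 2 * (\<Sum>i\<in>{0..<h + r}. \<eta> (j - i))" by (simp add: sum_distrib_left)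
  also have "\<dots> \<le> 2 * (\<Sum>k. \<eta> (k + q))"
    using j by (intro mult_left_mono sum_le_suminf_reflect eta_props) auto
  finally have far: "\<bar>\<Sum>i\<in>{0..<h + r}. ?t i\<bar> \<le> 2 * (\<Sum>k. \<eta> (k + q))" .
  have "(\<Sum>i\<in>{h + r..j}. ?t i) = (\<Sum>i\<in>{h..j - r}. ?t (i + r))"
  proof -
    have "j - r + r = j" using j by simp
    then show ?thesis using sum.shift_bounds_cl_nat_ivl[of ?t h r "j - r"] by (simp only:)
  qed
  then have "(\<Sum>i\<in>{h + r..j}. ?t i) - cov_row \<mu> T f h (j - r) ((shift ^^ r) \<omega>)
      = (\<Sum>i\<in>{h..j - r}. diag_weight (j - r - i) *
          (pair_cov \<mu> T f (i + r) (j - r - i) \<omega> - pair_cov \<mu> T f i (j - r - i) ((shift ^^ r) \<omega>)))"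
    unfolding cov_row_def by (simp add: sum_subtractf right_diff_distrib add.commute)
  also have "\<bar>\<dots>\<bar> \<le> (\<Sum>i\<in>{h..j - r}. 2 * (C1 * \<eta> h))"
  proof (intro order_trans[OF sum_abs] sum_mono)
    fix i assume "i \<in> {h..j - r}"
    then have "\<eta> i \<le> \<eta> h" using eta_props(1) by (simp add: antimono_def)
    then have "C1 * \<eta> i \<le> C1 * \<eta> h" using C1 by (rule mult_left_mono)
    then have "\<bar>pair_cov \<mu> T f (i + r) (j - r - i) \<omega> - pair_cov \<mu> T f i (j - r - i) ((shift ^^ r) \<omega>)\<bar> \<le> C1 * \<eta> h"
      using s3[rule_format, of i r "j - r - i"] by linarith
    then show "\<bar>diag_weight (j - r - i) *
          (pair_cov \<mu> T f (i + r) (j - r - i) \<omega> - pair_cov \<mu> T f i (j - r - i) ((shift ^^ r) \<omega>))\<bar>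
        \<le> 2 * (C1 * \<eta> h)"
      unfolding abs_mult using diag_weight_bounds by (intro mult_mono) auto
  qed
  also have "\<dots> = 2 * (real q + 1) * (C1 * \<eta> h)" using j by (simp add: algebra_simps)
  finally show ?thesis using split far by linarith
qed

text \<open>
  For \<open>d \<ge> 3 * a\<close> the gap between \<open>i\<close> and \<open>i + d\<close> is divided into three parts. The coordinates in the
  first part, of length \<open>a\<close>, separate the past of \<open>i\<close> from the start of the later composition, which
  allows mixing; the second, of length \<open>d - 2 * a\<close>, is the waiting time that makes \<open>SA3\<close> effective;
  and the entries of row \<open>i + d\<close> that are kept lie in the third, of length \<open>a\<close>.
\<close>
lemma covariance_decay:
  "\<exists>C\<ge>0. \<forall>i d. \<bar>(\<integral>\<omega>. cov_row \<mu> T f 0 i \<omega> * cov_row \<mu> T f 0 (i + d) \<omega> \<partial>P)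
      - (\<integral>\<omega>. cov_row \<mu> T f 0 i \<omega> \<partial>P) * (\<integral>\<omega>. cov_row \<mu> T f 0 (i + d) \<omega> \<partial>P)\<bar>
    \<le> poly_rate C (min (\<psi> - 1) \<gamma>) d"
proof -
  define m where "m = min (\<psi> - 1) \<gamma>"
  have m: "m > 0" "m \<le> \<psi> - 1" "m \<le> \<gamma>" using psi gamma by (auto simp: m_def)
  define w where "w = cov_row \<mu> T f 0"
  define Cv where "Cv X Y = (\<integral>\<omega>. X \<omega> * Y \<omega> \<partial>P) - (\<integral>\<omega>. X \<omega> \<partial>P) * (\<integral>\<omega>. Y \<omega> \<partial>P)"
    for X Y :: "(nat \<Rightarrow> 'o) \<Rightarrow> real"
  obtain C1 where C1: "C1 \<ge> 0" and s3: "AE \<omega> in P. \<forall>r i k.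
    \<bar>pair_cov \<mu> T f (r + i) k \<omega> - pair_cov \<mu> T f r k ((shift ^^ i) \<omega>)\<bar> \<le> C1 * \<eta> r"
    using SA3_pair_cov[OF SA3 eta_props(2)] by blast
  define H where "H = suminf \<eta>"
  have H: "H \<ge> 0" unfolding H_def by (intro suminf_nonneg eta_props)
  define E0 where "E0 = 2 * (A * (1 + 1 / (\<psi> - 1))) + 4 * (C1 * A)"
  have E0: "E0 \<ge> 0" using A_nonneg C1 psi by (simp add: E0_def)
  define B where "B = 2 * H + E0 + 1"
  have B: "B > 0" "2 * H \<le> B" using H E0 by (auto simp: B_def)
  have wm: "w i \<in> borel_measurable P" for i unfolding w_def borel_measurable_P by measurable
  have wB: "AE \<omega> in P. \<bar>w i \<omega>\<bar> \<le> B" for i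
    using AE_abs_cov_row_le[of 0 i] by eventually_elim (use B in \<open>simp add: w_def H_def\<close>)
  have trivial: "\<bar>Cv (w i) (w j)\<bar> \<le> 2 * B * B" for i j
    using P.covariance_perturb[OF wm[of i] wm[of j] _ wB wB, of "\<lambda>_. 0" B] wB[of j] B by (simp add: Cv_def)
  define D where "D = 4 * B * B * A' + 2 * B * E0"
  have D: "D \<ge> 0" using A'_nonneg B E0 by (simp add: D_def)
  have far: "\<bar>Cv (w i) (w (i + d))\<bar> \<le> D * real a powr (- m)" if a: "a \<ge> 1" "3 * a \<le> d" for i d a
  proof -
    define j r h where "j = i + d" and "r = i + a" and "h = d - 2 * a"
    have jh: "j = h + r + a" "a \<le> h" using a by (auto simp: j_def r_def h_def)
    define y where "y \<omega> = cov_row \<mu> T f h (j - r) ((shift ^^ r) \<omega>)" for \<omega>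
    have ym: "y \<in> borel_measurable P"
      unfolding y_def borel_measurable_P by (rule measurable_compose[OF measurable_shift_funpow measurable_cov_row])
    have e: "2 * (\<Sum>k. \<eta> (k + a)) + 2 * (real a + 1) * (C1 * \<eta> h) \<le> E0 * real a powr (1 - \<psi>)"
    proof -
      have "\<eta> h \<le> \<eta> a" using eta_props(1) jh(2) by (simp add: antimono_def)
      then have eta_h: "C1 * \<eta> h \<le> C1 * \<eta> a" using C1 by (rule mult_left_mono)
      have "(2 * (real a + 1)) * (C1 * \<eta> h) \<le> (4 * real a) * (C1 * \<eta> a)"
        by (rule mult_mono[OF _ eta_h]) (use a C1 eta_props(2)[of h] in simp_all)
      also have "\<dots> = 4 * (C1 * A) * real a powr (1 - \<psi>)"
        using a by (simp add: poly_rate_def powr_diff powr_minus divide_inverse)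
      finally show ?thesis
        using poly_rate_tail_le[OF psi a(1) A_nonneg eta_props(3)] by (simp add: E0_def distrib_right)
    qed
    have close: "AE \<omega> in P. \<bar>w j \<omega> - y \<omega>\<bar> \<le> E0 * real a powr (1 - \<psi>)"
      using SA1_pair_cov[OF SA1] s3
    proof eventually_elim
      case (elim \<omega>)
      show ?case using cov_row_shift_approx[OF elim C1 jh(1)] e unfolding w_def y_def by linarith
    qed
    have a_pow: "real a powr (1 - \<psi>) \<le> real a powr (- m)" "real a powr (- \<gamma>) \<le> real a powr (- m)"
      using a m by (auto intro!: powr_mono)
    have a1: "real a powr (1 - \<psi>) \<le> 1" using a psi powr_mono[of "1 - \<psi>" 0 "real a"] by simp
    have yB: "AE \<omega> in P. \<bar>y \<omega>\<bar> \<le> B"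
      using close AE_abs_cov_row_le[of 0 j]
    proof eventually_elim
      case (elim \<omega>)
      have "E0 * real a powr (1 - \<psi>) \<le> E0" using E0 a1 by (simp add: mult_left_le)
      then show ?case using elim by (simp add: w_def H_def B_def)
    qed
    have "\<bar>Cv (w i) (w j) - Cv (w i) y\<bar> \<le> 2 * B * (E0 * real a powr (1 - \<psi>))"
      unfolding Cv_def using B by (intro P.covariance_perturb wm ym wB yB close) auto
    moreover have "\<bar>Cv (w i) y\<bar> \<le> 4 * B * B * (A' * real a powr (- \<gamma>))"
      unfolding Cv_def
    proof (rule P.covariance_le_level_set_mixing[OF wm ym wB yB B(1) B(1)])
      fix s t
      \<comment> \<open>\<open>Suc i\<close> instead of \<open>i\<close>, because for \<open>i = 0\<close> the set of past coordinates must not be empty.\<close>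
      have "{\<omega> \<in> space P. s \<le> w i \<omega>} \<in> coord_sigma M0 {1..Suc i}"
        unfolding space_P w_def by (intro past_level_set measurable_cov_row cov_row_cong) auto
      moreover have "{\<omega> \<in> space P. t \<le> y \<omega>} \<in> coord_sigma M0 {Suc i + a..}"
        using future_level_set[OF measurable_cov_row, of t h "j - r" r] unfolding space_P y_def r_def by simp
      ultimately show "\<bar>P.prob ({\<omega> \<in> space P. s \<le> w i \<omega>} \<inter> {\<omega> \<in> space P. t \<le> y \<omega>})
          - P.prob {\<omega> \<in> space P. s \<le> w i \<omega>} * P.prob {\<omega> \<in> space P. t \<le> y \<omega>}\<bar> \<le> A' * real a powr (- \<gamma>)"
        using a by (intro mixing_coefficient) auto
    qed
    ultimately have "\<bar>Cv (w i) (w j)\<bar> \<le> 2 * B * (E0 * real a powr (1 - \<psi>)) + 4 * B * B * (A' * real a powr (- \<gamma>))"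
      by linarith
    also have "\<dots> \<le> 2 * B * (E0 * real a powr (- m)) + 4 * B * B * (A' * real a powr (- m))"
      using a_pow B E0 A'_nonneg by (intro add_mono mult_left_mono) auto
    finally show ?thesis unfolding j_def D_def by (simp add: algebra_simps)
  qed
  \<comment> \<open>With \<open>a = d div 3\<close> one has \<open>d \<le> 5 * a\<close>; the distances \<open>d < 3\<close> are covered by the trivial bound.\<close>
  define C where "C = 5 powr m * (D + 2 * B * B)"
  have five: "1 \<le> (5::real) powr m" using m by (simp add: ge_one_powr_ge_zero)
  have DB: "0 \<le> D + 2 * B * B" using D B by simp
  have "\<bar>Cv (w i) (w (i + d))\<bar> \<le> poly_rate C m d" for i d
  proof (cases "d < 3")
    case True
    have "1 \<le> 5 powr m * (if d = 0 then 1 else real d powr (- m))"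
    proof (cases "d = 0")
      case False
      have "5 powr m * real d powr (- m) = (5 / real d) powr m"
        by (simp add: powr_divide powr_minus_divide)
      also have "\<dots> \<ge> 1" using True False m by (intro ge_one_powr_ge_zero) auto
      finally show ?thesis using False by simp
    qed (use five in simp)
    then have "(D + 2 * B * B) * 1 \<le> (D + 2 * B * B) * (5 powr m * (if d = 0 then 1 else real d powr (- m)))"
      using DB by (rule mult_left_mono)
    then show ?thesis using trivial[of i "i + d"] D unfolding poly_rate_def C_def by (simp add: mult_ac)
  next
    case False
    define a where "a = d div 3"
    have a: "a \<ge> 1" "3 * a \<le> d" "d \<le> 5 * a" using False unfolding a_def by presburger+
    have "real a powr (- m) \<le> (real d / 5) powr (- m)"
      using a m by (intro powr_mono2') auto
    also have "\<dots> = 5 powr m * real d powr (- m)"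
      by (simp add: powr_divide powr_minus_divide)
    finally have "D * real a powr (- m) \<le> (D + 2 * B * B) * (5 powr m * real d powr (- m))"
      using D B by (intro mult_mono) auto
    then show ?thesis using far[OF a(1,2), of i] False by (simp add: poly_rate_def C_def mult_ac)
  qed
  moreover have "C \<ge> 0" using DB by (simp add: C_def)
  ultimately show ?thesis unfolding Cv_def w_def m_def by blast
qed

text \<open>
  By the decay of covariances a block of length \<open>n\<close> has variance \<open>O(n powr (2 - m'))\<close>, so the strong law
  applies with \<open>p = 2 - m'\<close>, and dividing by \<open>n\<close> leaves the exponent \<open>p / 2 - 1 = - m' / 2\<close>.
\<close>
lemma fluctuation_bound:
  assumes m': "0 < m'" "m' \<le> 1" "m' \<le> min (\<psi> - 1) \<gamma>" "m' = 1 \<longrightarrow> 1 < min (\<psi> - 1) \<gamma>"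
    and \<delta>: "\<delta> > 0"
  shows "AE \<omega> in P. (\<lambda>n. (\<Sum>j<n. cov_row \<mu> T f 0 j \<omega> - (\<integral>\<omega>. cov_row \<mu> T f 0 j \<omega> \<partial>P)) / real n)
    \<in> O(\<lambda>n. real n powr (- m' / 2) * ln (real n) powr (3 / 2 + \<delta>))"
proof -
  define H where "H = suminf \<eta>"
  have H: "2 * H \<ge> 0" unfolding H_def by (simp add: suminf_nonneg eta_props)
  let ?w = "cov_row \<mu> T f 0"
  obtain C where C: "C \<ge> 0" and cov: "\<And>i d. \<bar>(\<integral>\<omega>. ?w i \<omega> * ?w (i + d) \<omega> \<partial>P)
      - (\<integral>\<omega>. ?w i \<omega> \<partial>P) * (\<integral>\<omega>. ?w (i + d) \<omega> \<partial>P)\<bar> \<le> poly_rate C (min (\<psi> - 1) \<gamma>) d"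
    using covariance_decay by blast
  obtain C' where C': "C' \<ge> 0"
    "\<And>n. n \<ge> 1 \<Longrightarrow> (\<Sum>d<n. poly_rate C (min (\<psi> - 1) \<gamma>) d) \<le> C' * real n powr (1 - m')"
    using sum_poly_rate_le[OF C m'] by blast
  have wm: "?w i \<in> borel_measurable P" for i unfolding borel_measurable_P by measurable
  note var = P.block_variance_le[of ?w "2 * H", OF wm AE_abs_cov_row_le[folded H_def] H cov]
  have "AE \<omega> in P. (\<lambda>n. \<Sum>j<n. ?w j \<omega> - (\<integral>\<omega>. ?w j \<omega> \<partial>P))
      \<in> O(\<lambda>n. real n powr ((2 - m') / 2) * ln (real n) powr (3 / 2 + \<delta>))"
  proof (rule gal_koksma)
    fix m n :: nat
    show "integrable P (\<lambda>\<omega>. (\<Sum>i = m..<m + n. ?w i \<omega> - (\<integral>\<omega>. ?w i \<omega> \<partial>P))\<^sup>2)" by (rule var(1))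
    assume n: "n \<ge> 1"
    have "(\<integral>\<omega>. (\<Sum>i = m..<m + n. ?w i \<omega> - (\<integral>\<omega>. ?w i \<omega> \<partial>P))\<^sup>2 \<partial>P)
        \<le> real n * (2 * (\<Sum>d<n. poly_rate C (min (\<psi> - 1) \<gamma>) d))" by (rule var(2))
    also have "\<dots> \<le> real n * (2 * (C' * real n powr (1 - m')))"
      using C'(2)[OF n] by (intro mult_left_mono) auto
    also have "\<dots> = 2 * C' * (real n powr 1 * real n powr (1 - m'))" using n by simp
    also have "\<dots> = 2 * C' * real n powr (2 - m')" unfolding powr_add[symmetric] by simp
    finally show "(\<integral>\<omega>. (\<Sum>i = m..<m + n. ?w i \<omega> - (\<integral>\<omega>. ?w i \<omega> \<partial>P))\<^sup>2 \<partial>P) \<le> 2 * C' * real n powr (2 - m')" .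
  qed (use m' \<delta> in auto)
  then show ?thesis
  proof eventually_elim
    case (elim \<omega>)
    have "(\<lambda>n. (\<Sum>j<n. ?w j \<omega> - (\<integral>\<omega>. ?w j \<omega> \<partial>P)) / real n)
      \<in> O(\<lambda>n. real n powr ((2 - m') / 2) * ln (real n) powr (3 / 2 + \<delta>) / real n)"
      by (intro landau_o.big.divide_right elim) (auto intro: eventually_mono[OF eventually_gt_at_top[of 0]])
    also have "(\<lambda>n. real n powr ((2 - m') / 2) * ln (real n) powr (3 / 2 + \<delta>) / real n)
      = (\<lambda>n. real n powr (- m' / 2) * ln (real n) powr (3 / 2 + \<delta>))"
    proof
      fix n :: nat
      show "real n powr ((2 - m') / 2) * ln (real n) powr (3 / 2 + \<delta>) / real n
        = real n powr (- m' / 2) * ln (real n) powr (3 / 2 + \<delta>)"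
      proof (cases "n = 0")
        case False
        have "(2 - m') / 2 = 1 + - m' / 2" by simp
        then have "real n powr ((2 - m') / 2) = real n powr 1 * real n powr (- m' / 2)"
          by (simp only: powr_add)
        also have "\<dots> = real n * real n powr (- m' / 2)" by simp
        finally show ?thesis using False by simp
      qed simp
    qed
    finally show ?case .
  qed
qed

end

section \<open>The mean of the variance and the limit\<close>

lemma bigo_add_of_nonneg:
  fixes u v g h :: "nat \<Rightarrow> real"
  assumes "u \<in> O(g)" "v \<in> O(h)" "\<And>n. 0 \<le> g n" "\<And>n. 0 \<le> h n"
  shows "(\<lambda>n. u n + v n) \<in> O(\<lambda>n. g n + h n)"
proof (rule sum_in_bigo)
  have "g \<in> O(\<lambda>n. g n + h n)" "h \<in> O(\<lambda>n. g n + h n)"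
    using assms(3,4) by (auto intro!: landau_o.big_mono always_eventually)
  then show "u \<in> O(\<lambda>n. g n + h n)" "v \<in> O(\<lambda>n. g n + h n)"
    using assms(1,2) by (auto intro: landau_o.big_trans)
qed

context random_composition
begin

lemma integrable_comp_shift:
  fixes g :: "(nat \<Rightarrow> 'o) \<Rightarrow> real"
  assumes N: "prob_space N" "sets N = sets (seq_space M0)"
    and g: "g \<in> borel_measurable (seq_space M0)" "\<And>\<omega>. \<omega> \<in> space (seq_space M0) \<Longrightarrow> \<bar>g \<omega>\<bar> \<le> K"
  shows "integrable N (\<lambda>\<omega>. g ((shift ^^ i) \<omega>))"
proof -
  interpret N: prob_space N by (rule N(1))
  have sp: "space N = space (seq_space M0)" using N(2) by (rule sets_eq_imp_space_eq)
  show ?thesis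
  proof (rule N.integrable_const_bound[where B=K])
    show "AE \<omega> in N. norm (g ((shift ^^ i) \<omega>)) \<le> K"
      using g(2) measurable_space[OF measurable_shift_funpow] by (intro AE_I2) (auto simp: sp)
    show "(\<lambda>\<omega>. g ((shift ^^ i) \<omega>)) \<in> borel_measurable N"
      unfolding measurable_cong_sets[OF N(2) refl] by (rule measurable_compose[OF measurable_shift_funpow g(1)])
  qed
qed

lemma integrable_g_shift:
  assumes N: "prob_space N" "sets N = sets (seq_space M0)"
  shows "integrable N (\<lambda>\<omega>. g1 \<mu> T f r k ((shift ^^ i) \<omega>))" "integrable N (\<lambda>\<omega>. g2 \<mu> T f r k ((shift ^^ i) \<omega>))"
  by (rule integrable_comp_shift[OF N measurable_g1 abs_g1_le], assumption)
     (rule integrable_comp_shift[OF N measurable_g2 abs_g2_le], assumption)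

end

context mixing_composition
begin

text \<open>
  The expectations form an approximately stationary array. Since the averaging rate is at most \<open>1\<close>
  there, \<open>\<zeta>\<close> is lowered to \<open>min \<zeta> 1\<close>.
\<close>
lemma mean_variance_limit:
  assumes zeta: "\<zeta> > 0" and SA4: "SA4 M0 P Pbar \<mu> T f \<zeta>"
  shows "\<forall>k. convergent (mean_cov Pbar \<mu> T f k)"
    and "summable (\<lambda>k. \<bar>sigma_sq_term Pbar \<mu> T f k\<bar>)"
    and "(\<lambda>n. (\<Sum>j<n. \<integral>\<omega>. cov_row \<mu> T f 0 j \<omega> \<partial>P) / real n - sigma_sq Pbar \<mu> T f)
      \<in> O(\<lambda>n. real n powr (min \<zeta> 1 / \<psi> - min \<zeta> 1))"
proof -
  define a where "a i k = (\<integral>\<omega>. pair_cov \<mu> T f i k \<omega> \<partial>P)" for i k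
  define b where "b r k i = (\<integral>\<omega>. pair_cov \<mu> T f r k ((shift ^^ i) \<omega>) \<partial>P)" for r k i
  define L where "L r k = mean_cov Pbar \<mu> T f k r" for r k
  have Pbar: "prob_space Pbar" "sets Pbar = sets (seq_space M0)"
    using SA4 by (auto simp: SA4_def asymp_mean_stationary_def)
  note int_P = integrable_g_shift[OF prob_P sets_P]
  have int_pc: "integrable P (\<lambda>\<omega>. pair_cov \<mu> T f r k ((shift ^^ i) \<omega>))" for r k i
    unfolding pair_cov_def using int_P by simp
  have int_pc0: "integrable P (pair_cov \<mu> T f r k)" for r k using int_pc[of r k 0] by simp
  obtain C1 where C1: "C1 \<ge> 0" and s3: "AE \<omega> in P. \<forall>r i k.
    \<bar>pair_cov \<mu> T f (r + i) k \<omega> - pair_cov \<mu> T f r k ((shift ^^ i) \<omega>)\<bar> \<le> C1 * \<eta> r"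
    using SA3_pair_cov[OF SA3 eta_props(2)] by blast
  obtain C0 where C0: "C0 > 0" and avg: "\<And>n r k g. n \<ge> 1 \<Longrightarrow> g \<in> {g1 \<mu> T f r k, g2 \<mu> T f r k} \<Longrightarrow>
        \<bar>1 / real n * (\<Sum>i<n. \<integral>\<omega>. g ((shift ^^ i) \<omega>) \<partial>P) - (\<integral>\<omega>. g \<omega> \<partial>Pbar)\<bar>
          \<le> C0 * real n powr (- \<zeta>)"
    using SA4 unfolding SA4_def by blast
  interpret approx_stationary a b L \<eta> C1 "2 * C0" "min \<zeta> 1"
  proof
    show "\<bar>a i k\<bar> \<le> \<eta> k" for i k
    proof -
      have "AE \<omega> in P. \<bar>pair_cov \<mu> T f i k \<omega> - 0\<bar> \<le> \<eta> k"
        using SA1_pair_cov[OF SA1] by eventually_elim simp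
      from P.integral_diff_le[OF int_pc0 _ this] show ?thesis by (simp add: a_def)
    qed
    show "\<bar>a (r + i) k - b r k i\<bar> \<le> C1 * \<eta> r" for r i k
    proof -
      have "AE \<omega> in P. \<bar>pair_cov \<mu> T f (r + i) k \<omega> - pair_cov \<mu> T f r k ((shift ^^ i) \<omega>)\<bar> \<le> C1 * \<eta> r"
        using s3 by eventually_elim blast
      from P.integral_diff_le[OF int_pc0 int_pc this] show ?thesis by (simp add: a_def b_def)
    qed
    show "\<bar>(\<Sum>i<n. b r k i) / real n - L r k\<bar> \<le> 2 * C0 * real n powr (- min \<zeta> 1)"
      if n: "n \<ge> 1" for n r k
    proof -
      let ?A = "\<lambda>g. 1 / real n * (\<Sum>i<n. \<integral>\<omega>. g ((shift ^^ i) \<omega>) \<partial>P)"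
      have "(\<Sum>i<n. b r k i) / real n = ?A (g1 \<mu> T f r k) - ?A (g2 \<mu> T f r k)"
        unfolding b_def pair_cov_def using int_P by (simp add: sum_subtractf diff_divide_distrib)
      moreover have "L r k = (\<integral>\<omega>. g1 \<mu> T f r k \<omega> \<partial>Pbar) - (\<integral>\<omega>. g2 \<mu> T f r k \<omega> \<partial>Pbar)"
        unfolding L_def mean_cov_def using integrable_g_shift[OF Pbar, of r k 0] by simp
      moreover have "real n powr (- \<zeta>) \<le> real n powr (- min \<zeta> 1)"
        using n by (intro powr_mono) auto
      then have "C0 * real n powr (- \<zeta>) \<le> C0 * real n powr (- min \<zeta> 1)" using C0 by simp
      ultimately show ?thesis
        using avg[OF n insertI1, of r k] avg[OF n insertI2[OF singletonI], of r k] by linarith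
    qed
  qed (use eta_props C1 C0 zeta in auto)
  have L_eq: "(\<lambda>r. L r k) = mean_cov Pbar \<mu> T f k" for k by (simp add: L_def)
  have term_eq: "sigma_sq_term Pbar \<mu> T f k = diag_weight k * Linf k" for k
    by (simp add: sigma_sq_term_def diag_weight_def Linf_def L_eq)
  show "\<forall>k. convergent (mean_cov Pbar \<mu> T f k)" using convergent_L by (simp add: L_eq)
  show "summable (\<lambda>k. \<bar>sigma_sq_term Pbar \<mu> T f k\<bar>)" using summable_weighted_Linf by (simp add: term_eq)
  have "(\<integral>\<omega>. cov_row \<mu> T f 0 j \<omega> \<partial>P) = (\<Sum>i\<in>{0..j}. diag_weight (j - i) * a i (j - i))" for j
    unfolding cov_row_def a_def by (simp add: Bochner_Integration.integral_sum int_pc0)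
  then have "(\<Sum>j<n. \<integral>\<omega>. cov_row \<mu> T f 0 j \<omega> \<partial>P) = (\<Sum>k<n. diag_weight k * (\<Sum>i<n - k. a i k))" for n
    by (simp add: sum_rows_eq_sum_diagonals[symmetric])
  then show "(\<lambda>n. (\<Sum>j<n. \<integral>\<omega>. cov_row \<mu> T f 0 j \<omega> \<partial>P) / real n - sigma_sq Pbar \<mu> T f)
      \<in> O(\<lambda>n. real n powr (min \<zeta> 1 / \<psi> - min \<zeta> 1))"
    using weighted_average_bigo[OF refl psi] by (simp add: sigma_sq_def term_eq)
qed

lemma variance_rate:
  assumes zeta: "\<zeta> > 0" and SA4: "SA4 M0 P Pbar \<mu> T f \<zeta>"
    and m': "0 < m'" "m' \<le> 1" "m' \<le> min (\<psi> - 1) \<gamma>" "m' = 1 \<longrightarrow> 1 < min (\<psi> - 1) \<gamma>"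
    and \<delta>: "\<delta> > 0"
  shows "AE \<omega> in P. (\<lambda>n. sigma_n_sq \<mu> T f n \<omega> - sigma_sq Pbar \<mu> T f)
    \<in> O(\<lambda>n. real n powr (min \<zeta> 1 / \<psi> - min \<zeta> 1) + real n powr (- m' / 2) * ln (real n) powr (3 / 2 + \<delta>))"
  using fluctuation_bound[OF m' \<delta>] AE_space
proof eventually_elim
  case (elim \<omega>)
  let ?w = "cov_row \<mu> T f 0"
  have split: "sigma_n_sq \<mu> T f n \<omega> - sigma_sq Pbar \<mu> T f
      = ((\<Sum>j<n. \<integral>\<omega>. ?w j \<omega> \<partial>P) / real n - sigma_sq Pbar \<mu> T f)
        + (\<Sum>j<n. ?w j \<omega> - (\<integral>\<omega>. ?w j \<omega> \<partial>P)) / real n" for n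
    using sigma_n_sq_eq_cov_rows[of \<omega> n] elim(2)
    by (simp add: space_P sum_subtractf diff_divide_distrib)
  show ?case
    unfolding split by (rule bigo_add_of_nonneg[OF mean_variance_limit(3)[OF zeta SA4] elim(1)]) auto
qed

end

lemma log_factor_absorbed:
  fixes e e' c :: real
  assumes "e < e'"
  shows "(\<lambda>n. real n powr e * ln (real n) powr c) \<in> O(\<lambda>n. real n powr e')"
  using assms by real_asymp

lemma powr_bigo_powr_log:
  fixes e e' c :: real
  assumes "e \<le> e'" "c \<ge> 0"
  shows "(\<lambda>n. real n powr e) \<in> O(\<lambda>n. real n powr e' * ln (real n) powr c)"
proof (rule landau_o.big_mono, rule eventually_at_top_linorderI[of 3])
  fix n :: nat assume n: "3 \<le> n"
  have "exp 1 \<le> real n" using exp_le n by (metis of_nat_le_iff of_nat_numeral order_trans)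
  then have "1 \<le> ln (real n)" using n by (subst ln_ge_iff) auto
  then have "1 \<le> ln (real n) powr c" using assms by (simp add: ge_one_powr_ge_zero)
  moreover have "real n powr e \<le> real n powr e'" using n assms by (intro powr_mono) auto
  ultimately have "real n powr e * 1 \<le> real n powr e' * ln (real n) powr c" by (intro mult_mono) auto
  then show "norm (real n powr e) \<le> norm (real n powr e' * ln (real n) powr c)" by (simp add: abs_mult)
qed

theorem theorem4p1:
  fixes M0 :: "'o measure" and P Pbar :: "(nat \<Rightarrow> 'o) measure" and \<mu> :: "'x measure"
    and T :: "'o \<Rightarrow> 'x \<Rightarrow> 'x" and f :: "'x \<Rightarrow> real"
    and A A' \<psi> \<gamma> \<zeta> \<delta> :: real
  assumes setting: "random_composition M0 P \<mu> T f"
    and psi: "\<psi> > 1" and gamma: "\<gamma> > 0" and zeta: "\<zeta> > 0" and delta: "\<delta> > 0"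
    and SA1: "SA1 P \<mu> T f (poly_rate A \<psi>)"
    and SA2: "SA2 M0 P (\<lambda>n. A' * real n powr (- \<gamma>))"
    and SA3: "SA3 P \<mu> T f (poly_rate A \<psi>)"
    and SA4: "SA4 M0 P Pbar \<mu> T f \<zeta>"
  shows "\<exists>\<Omega>s\<in>sets P. measure P \<Omega>s = 1 \<and>
    (\<forall>k. convergent (mean_cov Pbar \<mu> T f k)) \<and>
    summable (\<lambda>k. \<bar>sigma_sq_term Pbar \<mu> T f k\<bar>) \<and>
    0 \<le> sigma_sq Pbar \<mu> T f \<and>
    (\<forall>\<omega>\<in>\<Omega>s.
      (\<lambda>n. sigma_n_sq \<mu> T f n \<omega>) \<longlonglongrightarrow> sigma_sq Pbar \<mu> T f \<and>
      (\<zeta> \<ge> 1 \<and> min (\<psi> - 1) \<gamma> > 1 \<longrightarrow>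
        Delta Pbar \<mu> T f \<omega> \<in> O(\<lambda>n. real n powr (- 1 / 2) * ln (real n) powr (3 / 2 + \<delta>))) \<and>
      (\<zeta> \<ge> 1 \<and> min (\<psi> - 1) \<gamma> = 1 \<longrightarrow>
        Delta Pbar \<mu> T f \<omega> \<in> O(\<lambda>n. real n powr (- 1 / 2 + \<delta>))) \<and>
      (\<zeta> \<ge> 1 \<and> 0 < min (\<psi> - 1) \<gamma> \<and> min (\<psi> - 1) \<gamma> < 1 \<longrightarrow>
        Delta Pbar \<mu> T f \<omega> \<in>
          O(\<lambda>n. real n powr (- min (\<psi> - 1) \<gamma> / 2) * ln (real n) powr (3 / 2 + \<delta>))) \<and>
      (0 < \<zeta> \<and> \<zeta> < 1 \<and> min (\<psi> - 1) \<gamma> > 1 \<longrightarrow>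
        Delta Pbar \<mu> T f \<omega> \<in>
          O(\<lambda>n. real n powr (\<zeta> / \<psi> - \<zeta>) +
                real n powr (- 1 / 2) * ln (real n) powr (3 / 2 + \<delta>))) \<and>
      (0 < \<zeta> \<and> \<zeta> < 1 \<and> min (\<psi> - 1) \<gamma> = 1 \<longrightarrow>
        Delta Pbar \<mu> T f \<omega> \<in>
          O(\<lambda>n. real n powr (\<zeta> / \<psi> - \<zeta>) + real n powr (- 1 / 2 + \<delta>))) \<and>
      (0 < \<zeta> \<and> \<zeta> < 1 \<and> 0 < min (\<psi> - 1) \<gamma> \<and> min (\<psi> - 1) \<gamma> < 1 \<longrightarrow>
        Delta Pbar \<mu> T f \<omega> \<in>
          O(\<lambda>n. real n powr (\<zeta> / \<psi> - \<zeta>) +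
                real n powr (- min (\<psi> - 1) \<gamma> / 2) * ln (real n) powr (3 / 2 + \<delta>))))"
proof -
  interpret mixing_composition M0 P \<mu> T f A A' \<psi> \<gamma>
    using setting psi gamma SA1 SA2 SA3 by (simp add: mixing_composition_def mixing_composition_axioms_def)
  define m where "m = min (\<psi> - 1) \<gamma>"
  \<comment> \<open>For \<open>m = 1\<close> any \<open>m'\<close> with \<open>max 0 (1 - 2 * \<delta>) < m' < 1\<close> leaves room to absorb the logarithm.\<close>
  define m' where "m' = (if m > 1 then 1 else if m < 1 then m else 1 - min \<delta> (1 / 2))"
  have m: "m > 0" "m \<le> \<psi> - 1" using psi gamma by (auto simp: m_def)
  have m': "0 < m'" "m' \<le> 1" "m' \<le> min (\<psi> - 1) \<gamma>" "m' = 1 \<longrightarrow> 1 < min (\<psi> - 1) \<gamma>"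
    using m delta unfolding m_def[symmetric] by (auto simp: m'_def)
  let ?D = "\<lambda>\<omega> n. sigma_n_sq \<mu> T f n \<omega> - sigma_sq Pbar \<mu> T f"
  define R1 where "R1 n = real n powr (min \<zeta> 1 / \<psi> - min \<zeta> 1)" for n :: nat
  define R2 where "R2 n = real n powr (- m' / 2) * ln (real n) powr (3 / 2 + \<delta>)" for n :: nat
  have nonneg: "0 \<le> R1 n" "0 \<le> R2 n" for n by (auto simp: R1_def R2_def)
  have "AE \<omega> in P. ?D \<omega> \<in> O(\<lambda>n. R1 n + R2 n)"
    unfolding R1_def R2_def by (rule variance_rate[OF zeta SA4 m' delta])
  then obtain N where N: "{\<omega> \<in> space P. \<not> ?D \<omega> \<in> O(\<lambda>n. R1 n + R2 n)} \<subseteq> N" "emeasure P N = 0" "N \<in> sets P"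
    by (rule AE_E)
  define \<Omega>s where "\<Omega>s = space P - N"
  have \<Omega>s: "\<Omega>s \<in> sets P" "measure P \<Omega>s = 1"
    using N P.prob_compl[of N] by (auto simp: \<Omega>s_def measure_def)
  have rate: "?D \<omega> \<in> O(\<lambda>n. R1 n + R2 n)" and in_space: "\<omega> \<in> space (seq_space M0)" if "\<omega> \<in> \<Omega>s" for \<omega>
    using that N(1) by (auto simp: \<Omega>s_def space_P)
  have z: "0 < min \<zeta> 1" using zeta by simp
  have R0: "(\<lambda>n. R1 n + R2 n) \<longlonglongrightarrow> 0"
  proof -
    have "min \<zeta> 1 / \<psi> < min \<zeta> 1 / 1" using psi z by (intro divide_strict_left_mono) auto
    then have "R1 \<longlonglongrightarrow> 0" unfolding R1_def
      by (intro tendsto_neg_powr filterlim_real_sequentially) auto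
    moreover have "R2 \<longlonglongrightarrow> 0" unfolding R2_def using m'(1) by real_asymp
    ultimately show ?thesis using tendsto_add[of R1 0 sequentially R2 0] by simp
  qed
  have lim: "(\<lambda>n. sigma_n_sq \<mu> T f n \<omega>) \<longlonglongrightarrow> sigma_sq Pbar \<mu> T f" if "\<omega> \<in> \<Omega>s" for \<omega>
  proof -
    have "(\<lambda>n. R1 n + R2 n) \<in> o(\<lambda>_. 1)" using R0 by (intro smalloI_tendsto) auto
    then have "?D \<omega> \<in> o(\<lambda>_. 1)" by (rule landau_o.big_small_trans[OF rate[OF that]])
    then have "?D \<omega> \<longlonglongrightarrow> 0" using smalloD_tendsto by fastforce
    then show ?thesis by (simp add: LIM_zero_iff)
  qed
  have pos: "0 \<le> sigma_sq Pbar \<mu> T f"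
  proof -
    have "\<Omega>s \<noteq> {}" using \<Omega>s(2) by auto
    then obtain \<omega> where \<omega>: "\<omega> \<in> \<Omega>s" by blast
    show ?thesis
      using lim[OF \<omega>] sigma_n_sq_nonneg[OF in_space[OF \<omega>]] by (intro LIMSEQ_le_const) auto
  qed
  have Delta: "Delta Pbar \<mu> T f \<omega> \<in> O(g)" if "?D \<omega> \<in> O(g)" for \<omega> g
    using that unfolding Delta_def by (subst landau_o.big.abs_in_iff) 
  \<comment> \<open>For \<open>\<zeta> \<ge> 1\<close> the error of the mean is dominated by the bound on the fluctuation.\<close>
  have R1_small: "R1 \<in> O(R2)" if "\<zeta> \<ge> 1"
  proof -
    have "m' / 2 \<le> 1 - 1 / \<psi>"
    proof (cases "\<psi> \<le> 2")
      case True
      have "m' / 2 \<le> (\<psi> - 1) / 2" using m' by simp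
      also have "\<dots> \<le> (\<psi> - 1) / \<psi>" using True psi by (intro divide_left_mono) auto
      finally show ?thesis using psi by (simp add: diff_divide_distrib)
    next
      case False
      then have "1 / \<psi> \<le> 1 / 2" by (intro divide_left_mono) auto
      then show ?thesis using m' by linarith
    qed
    then show ?thesis unfolding R1_def R2_def using that delta by (intro powr_bigo_powr_log) auto
  qed
  have fast: "Delta Pbar \<mu> T f \<omega> \<in> O(R2)" if "\<zeta> \<ge> 1" "\<omega> \<in> \<Omega>s" for \<omega>
    by (intro Delta landau_o.big_trans[OF rate[OF that(2)]] sum_in_bigo R1_small that) simp
  have slow: "Delta Pbar \<mu> T f \<omega> \<in> O(\<lambda>n. real n powr (\<zeta> / \<psi> - \<zeta>) + R2 n)" if "\<zeta> < 1" "\<omega> \<in> \<Omega>s" for \<omega>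
    using Delta[OF rate[OF that(2)]] that(1) by (simp add: R1_def min_def)
  have R2_gt: "R2 = (\<lambda>n. real n powr (- 1 / 2) * ln (real n) powr (3 / 2 + \<delta>))" if "m > 1"
    using that by (simp add: R2_def m'_def fun_eq_iff)
  have R2_lt: "R2 = (\<lambda>n. real n powr (- m / 2) * ln (real n) powr (3 / 2 + \<delta>))" if "m < 1"
    using that by (simp add: R2_def m'_def fun_eq_iff)
  have R2_eq: "R2 \<in> O(\<lambda>n. real n powr (- 1 / 2 + \<delta>))" if "m = 1"
  proof -
    have "- m' / 2 < - 1 / 2 + \<delta>" using that delta by (simp add: m'_def min_def)
    then show ?thesis unfolding R2_def by (rule log_factor_absorbed)
  qed
  have slow_eq: "Delta Pbar \<mu> T f \<omega> \<in> O(\<lambda>n. real n powr (\<zeta> / \<psi> - \<zeta>) + real n powr (- 1 / 2 + \<delta>))"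
    if "\<zeta> < 1" "m = 1" "\<omega> \<in> \<Omega>s" for \<omega>
    by (rule landau_o.big_trans[OF slow[OF that(1,3)]], rule bigo_add_of_nonneg) (use R2_eq[OF that(2)] in auto)
  show ?thesis
  proof (intro bexI[of _ \<Omega>s] conjI ballI impI)
    show "measure P \<Omega>s = 1" "\<Omega>s \<in> sets P" by (rule \<Omega>s)+
    show "\<forall>k. convergent (mean_cov Pbar \<mu> T f k)" by (rule mean_variance_limit(1)[OF zeta SA4])
    show "summable (\<lambda>k. \<bar>sigma_sq_term Pbar \<mu> T f k\<bar>)" by (rule mean_variance_limit(2)[OF zeta SA4])
    show "0 \<le> sigma_sq Pbar \<mu> T f" by (rule pos)
  next
    fix \<omega> assume \<omega>: "\<omega> \<in> \<Omega>s"
    show "(\<lambda>n. sigma_n_sq \<mu> T f n \<omega>) \<longlonglongrightarrow> sigma_sq Pbar \<mu> T f" by (rule lim[OF \<omega>])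
  next
    fix \<omega> assume \<omega>: "\<omega> \<in> \<Omega>s" and "\<zeta> \<ge> 1 \<and> min (\<psi> - 1) \<gamma> > 1"
    then show "Delta Pbar \<mu> T f \<omega> \<in> O(\<lambda>n. real n powr (- 1 / 2) * ln (real n) powr (3 / 2 + \<delta>))"
      using fast[OF _ \<omega>] R2_gt unfolding m_def by simp
  next
    fix \<omega> assume \<omega>: "\<omega> \<in> \<Omega>s" and c: "\<zeta> \<ge> 1 \<and> min (\<psi> - 1) \<gamma> = 1"
    then show "Delta Pbar \<mu> T f \<omega> \<in> O(\<lambda>n. real n powr (- 1 / 2 + \<delta>))"
      using landau_o.big_trans[OF fast[OF _ \<omega>] R2_eq] unfolding m_def by blast
  next
    fix \<omega> assume \<omega>: "\<omega> \<in> \<Omega>s" and "\<zeta> \<ge> 1 \<and> 0 < min (\<psi> - 1) \<gamma> \<and> min (\<psi> - 1) \<gamma> < 1"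
    then show "Delta Pbar \<mu> T f \<omega> \<in>
        O(\<lambda>n. real n powr (- min (\<psi> - 1) \<gamma> / 2) * ln (real n) powr (3 / 2 + \<delta>))"
      using fast[OF _ \<omega>] R2_lt unfolding m_def by simp
  next
    fix \<omega> assume \<omega>: "\<omega> \<in> \<Omega>s" and "0 < \<zeta> \<and> \<zeta> < 1 \<and> min (\<psi> - 1) \<gamma> > 1"
    then show "Delta Pbar \<mu> T f \<omega> \<in>
        O(\<lambda>n. real n powr (\<zeta> / \<psi> - \<zeta>) + real n powr (- 1 / 2) * ln (real n) powr (3 / 2 + \<delta>))"
      using slow[OF _ \<omega>] R2_gt unfolding m_def by simp
  next
    fix \<omega> assume \<omega>: "\<omega> \<in> \<Omega>s" and "0 < \<zeta> \<and> \<zeta> < 1 \<and> min (\<psi> - 1) \<gamma> = 1"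
    then show "Delta Pbar \<mu> T f \<omega> \<in>
        O(\<lambda>n. real n powr (\<zeta> / \<psi> - \<zeta>) + real n powr (- 1 / 2 + \<delta>))"
      using slow_eq[OF _ _ \<omega>] unfolding m_def by simp
  next
    fix \<omega> assume \<omega>: "\<omega> \<in> \<Omega>s" and "0 < \<zeta> \<and> \<zeta> < 1 \<and> 0 < min (\<psi> - 1) \<gamma> \<and> min (\<psi> - 1) \<gamma> < 1"
    then show "Delta Pbar \<mu> T f \<omega> \<in>
        O(\<lambda>n. real n powr (\<zeta> / \<psi> - \<zeta>) +
          real n powr (- min (\<psi> - 1) \<gamma> / 2) * ln (real n) powr (3 / 2 + \<delta>))"
      using slow[OF _ \<omega>] R2_lt unfolding m_def by simp
  qed
qed

end
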